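(* Let $q\in\mathbb{C}$ with $0<|q|<1$. For generic $z\in\mathbb{C}^*$, $$D_{4}(-z^{-5},z,z^{16};q)=D_{4}(-z^{-5},-z^4,z^{16};q)=\frac{q^{-1}z^{10}(q;q)_{\infty}(q^4;q^4)_{\infty}^3(q^{16};q^{16})_{\infty}\,\Theta(z^2;q)}{(q^{8};q^{8})_{\infty}\,\Theta(z;q)\,\Theta(-qz^{4};q^2)\,\Theta(-q^2z^{4};q^{4})\,\Theta(z^{16};q^{16})}.$$
   Context: $\mathbb{C}^*=\mathbb{C}\setminus\{0\}$. For $Q\in\mathbb{C}$ with $0<|Q|<1$ and $x\in\mathbb{C}$, $(x;Q)_\infty=\prod_{i\ge 0}(1-Q^i x)$. For $x\in\mathbb{C}^*$, $$\Theta(x;Q)=(x;Q)_\infty(Q/x;Q)_\infty(Q;Q)_\infty=\sum_{n=-\infty}^{\infty}(-1)^nQ^{\binom n2}x^n .$$ The Appell function is $$m(x,z;Q)=\frac{1}{\Theta(z;Q)}\sum_{r=-\infty}^{\infty}\frac{(-1)^rQ^{\binom r2}z^r}{1-Q^{r-1}xz},$$ defined when neither $z$ nor $xz$ is an integral power of $Q$. Further, $$D_4(x,z,z';q)=m(x,z;q)-m(-q^{6}x^4,z';q^{16})+q^{-1}x\,m(-q^{2}x^4,z';q^{16})-q^{-3}x^2\,m(-q^{-2}x^4,z';q^{16})+q^{-6}x^3\,m(-q^{-6}x^4,z';q^{16}).$$ "Generic" means that all Appell functions occurring are defined and no denominator vanishes. *)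

theory Defs
  imports "HOL-Analysis.Analysis"
begin

text \<open>The base \<^term>\<open>Q :: complex\<close> is the last argument of each function. All functions are total;
  they have their intended meaning only for \<^prop>\<open>0 < norm (Q :: complex) \<and> norm Q < 1\<close> and, apart
  from the argument of the infinite Pochhammer symbol, nonzero arguments.\<close>

definition qpochhammer_inf :: "complex \<Rightarrow> complex \<Rightarrow> complex" where
  "qpochhammer_inf x Q = (\<Prod>i. 1 - Q ^ i * x)"

definition Theta :: "complex \<Rightarrow> complex \<Rightarrow> complex" where
  "Theta x Q = qpochhammer_inf x Q * qpochhammer_inf (Q / x) Q * qpochhammer_inf Q Q"

text \<open>The exponent \<^term>\<open>r * (r - 1) div 2 :: int\<close> is the binomial coefficient ``r choose 2'',
  for negative r as well; the division is exact. Where \<^emph>\<open>m\<close> is meant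
  to be defined, the bilateral series converges absolutely, so it is an unordered sum over \<^typ>\<open>int\<close>.\<close>

definition appell_m :: "complex \<Rightarrow> complex \<Rightarrow> complex \<Rightarrow> complex" where
  "appell_m x z Q =
     1 / Theta z Q *
     (\<Sum>\<^sub>\<infinity>r::int. (-1) powi r * Q powi (r * (r - 1) div 2) * z powi r
                 / (1 - Q powi (r - 1) * x * z))"

definition appell_m_defined :: "complex \<Rightarrow> complex \<Rightarrow> complex \<Rightarrow> bool" where
  "appell_m_defined x z Q \<longleftrightarrow> (\<forall>k::int. z \<noteq> Q powi k \<and> x * z \<noteq> Q powi k)"

definition D4 :: "complex \<Rightarrow> complex \<Rightarrow> complex \<Rightarrow> complex \<Rightarrow> complex" where
  "D4 x z z' q =
     appell_m x z q
     - appell_m (- (q ^ 6 * x ^ 4)) z' (q ^ 16)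
     + q powi (-1) * x * appell_m (- (q ^ 2 * x ^ 4)) z' (q ^ 16)
     - q powi (-3) * x ^ 2 * appell_m (- (q powi (-2) * x ^ 4)) z' (q ^ 16)
     + q powi (-6) * x ^ 3 * appell_m (- (q powi (-6) * x ^ 4)) z' (q ^ 16)"

definition D4_defined :: "complex \<Rightarrow> complex \<Rightarrow> complex \<Rightarrow> complex \<Rightarrow> bool" where
  "D4_defined x z z' q \<longleftrightarrow>
     appell_m_defined x z q \<and>
     appell_m_defined (- (q ^ 6 * x ^ 4)) z' (q ^ 16) \<and>
     appell_m_defined (- (q ^ 2 * x ^ 4)) z' (q ^ 16) \<and>
     appell_m_defined (- (q powi (-2) * x ^ 4)) z' (q ^ 16) \<and>
     appell_m_defined (- (q powi (-6) * x ^ 4)) z' (q ^ 16)"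

end

theory Submission
  imports Defs "HOL-Complex_Analysis.Complex_Analysis"
begin

text \<open>Both equalities are instances of one multisection theorem for the Appell function. Formally,
\<open>m(x,u;q)\<close> is the (divergent) series \<open>\<Sum>r\<ge>0. (-1)^r q^(-r(r+1)/2) x^r\<close>, and collecting the exponents
by their residue class modulo \<open>n\<close> turns it into a combination of \<open>n\<close> Appell functions with base
\<open>q^(n^2)\<close> and any second argument \<open>w\<close>. The actual functions differ by a quotient of theta functions,
which \<open>appell_m_multisection\<close> determines.

The reason is rigidity. Let \<open>F(x)\<close> be the difference between \<open>m(x,u;q)\<close> and the combination, with
\<open>u\<close> and \<open>w\<close> fixed. The functional equation \<open>m(qx,u;q) = 1 - x m(x,u;q)\<close> permutes the parts of the
combination cyclically, and the inhomogeneous terms cancel, so that \<open>F(qx) = - x F(x)\<close>. A theta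
quotient \<open>R\<close> with the same functional equation is subtracted, and \<open>F - R\<close> is multiplied by
\<open>\<Theta>(xu;q)\<close>, which removes the poles at \<open>xu = q^k\<close>. The result is multiplied by \<open>1/u\<close> under \<open>x \<mapsto> qx\<close>.
If its other singularities are removable, then it is a holomorphic function on the punctured plane
with a multiplier that is not an integral power of \<open>q\<close>, and such a function is zero
(\<open>quasi_periodic_eq_0\<close>). The other singularities come from the functions with base \<open>q^(n^2)\<close>. Up to
\<open>x \<mapsto> qx\<close> they lie at the points where \<open>y = - q^(n(n-1)/2) (-x)^n w\<close> equals 1, and there the residues
of \<open>F\<close> and \<open>R\<close> agree because the theta series, sorted by residue classes modulo \<open>n\<close>, is a
combination of theta series with base \<open>q^(n^2)\<close> (\<open>Theta_multisection\<close>). This uses the Jacobi triple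
product (\<open>theta_term_has_sum\<close>).

For \<open>n = 1\<close> the theorem compares \<open>m(x,z;q)\<close> with \<open>m(x,w;q)\<close>. If \<open>w = 1/(xz)\<close>, then \<open>R\<close> has a factor
\<open>\<Theta>(1;q) = 0\<close> and the two values agree (\<open>appell_m_swap\<close>). For \<open>x = -z^(-5)\<close> this \<open>w\<close> is \<open>-z^4\<close>, which
gives the first equality. For \<open>n = 4\<close> the function \<open>F\<close> is \<open>D4\<close>. The second arguments \<open>u = -z^4\<close> and
\<open>w = z^16 = u^4\<close> make two of the four summands of \<open>R\<close> vanish, and the remaining two are, up to a
common factor, the even and the odd part of the theta series of \<open>\<Theta>(z^2;q)\<close>
(\<open>theta_numerator_special\<close>). The constants are then collected by elementary product identities.\<close>

section \<open>Infinite products and the theta function\<close>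

text \<open>Uniform convergence on discs, from the geometric majorant \<open>|Q|^n R\<close>, makes the infinite
  product an entire function of \<open>x\<close>.\<close>

lemma qpochhammer_inf_uniform_limit:
  fixes Q :: complex
  assumes "norm Q < 1"
  shows "uniform_limit (cball 0 R) (\<lambda>N x. \<Prod>n<N. 1 - Q ^ n * x) (\<lambda>x. qpochhammer_inf x Q) sequentially"
    and "convergent_prod (\<lambda>n. 1 - Q ^ n * x)"
proof -
  have conv: "convergent_prod (\<lambda>n. 1 - Q ^ n * x)" for x
  proof -
    have "summable (\<lambda>n. norm Q ^ n * norm x)"
      using assms by (intro summable_mult2 summable_geometric) auto
    hence "summable (\<lambda>n. norm ((1 - Q ^ n * x) - 1))"
      by (simp add: norm_mult norm_power)
    hence "abs_convergent_prod (\<lambda>n. 1 - Q ^ n * x)"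
      by (rule summable_imp_abs_convergent_prod)
    thus ?thesis by (rule abs_convergent_prod_imp_convergent_prod)
  qed
  show "convergent_prod (\<lambda>n. 1 - Q ^ n * x)" by (rule conv)
  have "uniformly_convergent_on (cball 0 R) (\<lambda>N x. \<Prod>n<N. 1 + (- (Q ^ n * x)))"
  proof (rule uniformly_convergent_on_prod)
    show "uniformly_convergent_on (cball 0 R) (\<lambda>N x. \<Sum>n<N. norm (- (Q ^ n * x)))"
    proof (rule Weierstrass_m_test')
      show "norm (norm (- (Q ^ n * x))) \<le> norm Q ^ n * R" if "x \<in> cball 0 R" for n x
        using that by (auto simp: norm_mult norm_power intro!: mult_left_mono)
      show "summable (\<lambda>n. norm Q ^ n * R)"
        using assms by (intro summable_mult2 summable_geometric) auto
    qed
  qed (auto intro!: continuous_intros)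
  then obtain g where g: "uniform_limit (cball 0 R) (\<lambda>N x. \<Prod>n<N. 1 - Q ^ n * x) g sequentially"
    by (auto simp: uniformly_convergent_on_def)
  have "g x = qpochhammer_inf x Q" if "x \<in> cball 0 R" for x
  proof -
    have "(\<lambda>N. \<Prod>n<N. 1 - Q ^ n * x) \<longlonglongrightarrow> g x"
      using tendsto_uniform_limitI[OF g that] .
    hence 1: "(\<lambda>N. \<Prod>n<Suc N. 1 - Q ^ n * x) \<longlonglongrightarrow> g x"
      by (rule LIMSEQ_Suc)
    have "(\<lambda>N. \<Prod>n\<le>N. 1 - Q ^ n * x) \<longlonglongrightarrow> qpochhammer_inf x Q"
      unfolding qpochhammer_inf_def by (rule convergent_prod_LIMSEQ[OF conv])
    with 1 show ?thesis
      unfolding lessThan_Suc_atMost by (rule LIMSEQ_unique)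
  qed
  hence "uniform_limit (cball 0 R) (\<lambda>N x. \<Prod>n<N. 1 - Q ^ n * x) (\<lambda>x. qpochhammer_inf x Q) sequentially
      \<longleftrightarrow> uniform_limit (cball 0 R) (\<lambda>N x. \<Prod>n<N. 1 - Q ^ n * x) g sequentially"
    by (intro uniform_limit_cong) auto
  with g show "uniform_limit (cball 0 R) (\<lambda>N x. \<Prod>n<N. 1 - Q ^ n * x) (\<lambda>x. qpochhammer_inf x Q) sequentially"
    by simp
qed

lemma qpochhammer_inf_tendsto:
  fixes Q :: complex
  assumes "norm Q < 1"
  shows "(\<lambda>N. \<Prod>n<N. 1 - Q ^ n * x) \<longlonglongrightarrow> qpochhammer_inf x Q"
  by (rule tendsto_uniform_limitI[OF qpochhammer_inf_uniform_limit(1)[OF assms, of "norm x"]]) auto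

lemma qpochhammer_inf_holomorphic:
  fixes Q :: complex
  assumes "norm Q < 1"
  shows "(\<lambda>x. qpochhammer_inf x Q) holomorphic_on A"
proof -
  have "(\<lambda>x. qpochhammer_inf x Q) holomorphic_on ball 0 R" for R
    by (rule holomorphic_uniform_limit[OF _ qpochhammer_inf_uniform_limit(1)[OF assms, of R]])
       (auto intro!: always_eventually continuous_intros holomorphic_intros)
  hence "(\<lambda>x. qpochhammer_inf x Q) analytic_on UNIV"
    unfolding analytic_on_def by (metis UNIV_I dist_0_norm gt_ex holomorphic_on_open
        holomorphic_on_subset mem_ball open_ball open_contains_ball)
  thus ?thesis
    using analytic_imp_holomorphic holomorphic_on_subset by blast
qed

lemma qpochhammer_inf_rec:
  fixes Q :: complex
  assumes "norm Q < 1"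
  shows "qpochhammer_inf x Q = (1 - x) * qpochhammer_inf (Q * x) Q"
proof -
  have "(\<lambda>N. (1 - x) * (\<Prod>n<N. 1 - Q ^ n * (Q * x))) \<longlonglongrightarrow> (1 - x) * qpochhammer_inf (Q * x) Q"
    by (intro tendsto_intros qpochhammer_inf_tendsto assms)
  moreover have "(1 - x) * (\<Prod>n<N. 1 - Q ^ n * (Q * x)) = (\<Prod>n<Suc N. 1 - Q ^ n * x)" for N
    by (subst prod.lessThan_Suc_shift) (simp add: mult_ac)
  ultimately have "(\<lambda>N. \<Prod>n<Suc N. 1 - Q ^ n * x) \<longlonglongrightarrow> (1 - x) * qpochhammer_inf (Q * x) Q"
    by simp
  thus ?thesis
    using LIMSEQ_Suc[OF qpochhammer_inf_tendsto[OF assms, of x]] LIMSEQ_unique by blast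
qed

lemma qpochhammer_inf_eq_0_iff:
  fixes Q :: complex
  assumes "norm Q < 1"
  shows "qpochhammer_inf x Q = 0 \<longleftrightarrow> (\<exists>i. Q ^ i * x = 1)"
  using has_prod_eq_0_iff[OF convergent_prod_has_prod[OF qpochhammer_inf_uniform_limit(2)[OF assms, of x]]]
  by (auto simp: qpochhammer_inf_def)

lemma qpochhammer_inf_self_nonzero:
  fixes Q :: complex
  assumes "norm Q < 1"
  shows "qpochhammer_inf Q Q \<noteq> 0"
proof -
  have "Q ^ i * Q \<noteq> 1" for i
  proof
    assume "Q ^ i * Q = 1"
    hence "norm Q ^ Suc i = 1"
      by (metis norm_one norm_power power_Suc2)
    moreover have "norm Q ^ Suc i < 1"
      using assms power_less_one_iff[of "norm Q" "Suc i"] by auto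
    ultimately show False by simp
  qed
  thus ?thesis
    using assms by (simp add: qpochhammer_inf_eq_0_iff)
qed

text \<open>The theta function with its zero at 1 divided out. Its value at 1 governs the residues of
  theta quotients.\<close>

definition regular_Theta :: "complex \<Rightarrow> complex \<Rightarrow> complex" where
  "regular_Theta x Q = qpochhammer_inf (Q * x) Q * qpochhammer_inf (Q / x) Q * qpochhammer_inf Q Q"

lemma Theta_eq_regular: "norm Q < 1 \<Longrightarrow> Theta x Q = (1 - x) * regular_Theta x Q"
  unfolding Theta_def regular_Theta_def by (subst qpochhammer_inf_rec) auto

lemma regular_Theta_1: "regular_Theta 1 Q = qpochhammer_inf Q Q ^ 3"
  by (simp add: regular_Theta_def power3_eq_cube)

lemma Theta_1 [simp]: "norm Q < 1 \<Longrightarrow> Theta 1 Q = 0"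
  by (simp add: Theta_eq_regular)

lemma qpochhammer_inf_analytic:
  assumes "norm Q < 1" "f analytic_on A"
  shows "(\<lambda>x. qpochhammer_inf (f x) Q) analytic_on A"
proof -
  have "(\<lambda>x. qpochhammer_inf x Q) analytic_on UNIV"
    using qpochhammer_inf_holomorphic[OF assms(1)] by (simp add: analytic_on_open)
  hence "(\<lambda>x. qpochhammer_inf x Q) analytic_on (f ` A)"
    using analytic_on_subset by blast
  from analytic_on_compose[OF assms(2) this] show ?thesis
    by (simp add: o_def)
qed

lemma Theta_analytic:
  assumes "norm Q < 1" "f analytic_on A" "\<And>x. x \<in> A \<Longrightarrow> f x \<noteq> 0"
  shows "(\<lambda>x. Theta (f x) Q) analytic_on A"
  unfolding Theta_def by (intro analytic_intros qpochhammer_inf_analytic assms)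

lemma regular_Theta_analytic:
  assumes "norm Q < 1" "f analytic_on A" "\<And>x. x \<in> A \<Longrightarrow> f x \<noteq> 0"
  shows "(\<lambda>x. regular_Theta (f x) Q) analytic_on A"
  unfolding regular_Theta_def by (intro analytic_intros qpochhammer_inf_analytic assms)

text \<open>Replacing \<open>x\<close> by \<open>Q x\<close> trades the factor \<open>1 - x\<close> of the first product for the factor
  \<open>1 - 1/x = - (1 - x)/x\<close> of the second.\<close>

lemma Theta_shift:
  assumes "norm Q < 1" "Q \<noteq> 0" "x \<noteq> 0"
  shows "Theta (Q * x) Q = - Theta x Q / x"
proof -
  have 1: "qpochhammer_inf (1 / x) Q = (1 - 1 / x) * qpochhammer_inf (Q / x) Q"
    using qpochhammer_inf_rec[OF assms(1), of "1 / x"] by simp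
  have 2: "qpochhammer_inf x Q = (1 - x) * qpochhammer_inf (Q * x) Q"
    by (rule qpochhammer_inf_rec[OF assms(1)])
  have "Theta (Q * x) Q = qpochhammer_inf (Q * x) Q * qpochhammer_inf (1 / x) Q * qpochhammer_inf Q Q"
    using assms by (simp add: Theta_def)
  moreover have "Theta x Q = (1 - x) * qpochhammer_inf (Q * x) Q * qpochhammer_inf (Q / x) Q * qpochhammer_inf Q Q"
    by (simp add: Theta_def 2)
  moreover have "1 - 1 / x = - (1 - x) / x"
    using assms by (simp add: field_simps)
  ultimately have "Theta (Q * x) Q = qpochhammer_inf (Q * x) Q * (- (1 - x) / x * qpochhammer_inf (Q / x) Q) * qpochhammer_inf Q Q"
    "Theta x Q = (1 - x) * qpochhammer_inf (Q * x) Q * qpochhammer_inf (Q / x) Q * qpochhammer_inf Q Q"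
    by (simp_all only: 1)
  thus ?thesis
    using assms by (simp only:) (simp add: field_simps)
qed

lemma Theta_eq_0_iff:
  assumes "norm Q < 1" "Q \<noteq> 0" "x \<noteq> 0"
  shows "Theta x Q = 0 \<longleftrightarrow> (\<exists>k::int. x = Q powi k)"
proof
  assume "Theta x Q = 0"
  hence "(\<exists>i. Q ^ i * x = 1) \<or> (\<exists>i. Q ^ i * (Q / x) = 1)"
    using assms qpochhammer_inf_self_nonzero
    by (simp add: Theta_def qpochhammer_inf_eq_0_iff)
  thus "\<exists>k::int. x = Q powi k"
  proof (elim disjE exE)
    fix i assume "Q ^ i * x = 1"
    hence "x = Q powi (- int i)"
      using assms by (simp add: power_int_minus field_simps)
    thus ?thesis by blast
  next
    fix i assume "Q ^ i * (Q / x) = 1"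
    hence "x = Q powi (int (Suc i))"
      using assms unfolding power_int_of_nat by (simp add: field_simps)
    thus ?thesis by blast
  qed
next
  assume "\<exists>k::int. x = Q powi k"
  then obtain k where k: "x = Q powi k" by blast
  show "Theta x Q = 0"
  proof (cases "k \<le> 0")
    case True
    hence "Q ^ nat (-k) * x = 1"
      using assms by (simp add: k flip: power_int_of_nat power_int_add)
    thus ?thesis
      using assms by (auto simp: Theta_def qpochhammer_inf_eq_0_iff)
  next
    case False
    hence "Q ^ nat (k - 1) * (Q / x) = Q powi (k - 1) * Q powi 1 * Q powi (- k)"
      using assms by (simp add: k power_int_minus divide_inverse flip: power_int_of_nat)
    also have "\<dots> = Q powi (k - 1 + 1 + - k)"
      using assms by (simp only: power_int_add simp_thms)
    also have "\<dots> = 1"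
      by simp
    finally show ?thesis
      using assms by (auto simp: Theta_def qpochhammer_inf_eq_0_iff)
  qed
qed

section \<open>The Jacobi triple product\<close>

text \<open>The exponent of the theta series; half of a product of consecutive integers, so that the
  division is exact.\<close>

definition choose2 :: "int \<Rightarrow> int" where "choose2 r = r * (r - 1) div 2"

lemma two_choose2: "2 * choose2 r = r * (r - 1)"
  unfolding choose2_def by (rule dvd_mult_div_cancel) simp

lemma choose2_add: "choose2 (r + s) = choose2 r + choose2 s + r * s"
proof -
  have "2 * choose2 (r + s) = 2 * (choose2 r + choose2 s + r * s)"
    unfolding distrib_left two_choose2 by (simp add: algebra_simps)
  thus ?thesis by simp
qed

lemma choose2_simps [simp]: "choose2 0 = 0" "choose2 1 = 0"
  by (simp_all add: choose2_def)

text \<open>Because of this identity the terms of a theta series whose index is a multiple of \<open>n\<close> form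
  a theta series again, with base \<open>Q^(n^2)\<close>.\<close>

lemma choose2_mult: "choose2 (n * k) = n\<^sup>2 * choose2 k + k * choose2 n"
proof -
  have "2 * choose2 (n * k) = n\<^sup>2 * (2 * choose2 k) + k * (2 * choose2 n)"
    unfolding two_choose2 by (simp add: algebra_simps power2_eq_square)
  thus ?thesis by simp
qed

definition theta_term :: "complex \<Rightarrow> complex \<Rightarrow> int \<Rightarrow> complex" where
  "theta_term z Q r = (-1) powi r * Q powi choose2 r * z powi r"

lemma theta_term_add:
  assumes "Q \<noteq> 0" "z \<noteq> 0"
  shows "theta_term z Q (r + s) = theta_term z Q r * theta_term (Q powi r * z) Q s"
  using assms by (simp add: theta_term_def choose2_add power_int_add power_int_mult_distrib
      flip: power_int_mult)

lemma theta_term_Suc: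
  assumes "Q \<noteq> 0" "z \<noteq> 0"
  shows "theta_term z Q (r + 1) = - (z * Q powi r) * theta_term z Q r"
  using theta_term_add[OF assms, of r 1] assms by (simp add: theta_term_def)

text \<open>The quotient of consecutive terms is \<open>- z Q^r\<close>, which settles the nonnegative indices. The
  reflection \<open>r \<mapsto> -r\<close> turns \<open>z\<close> into \<open>Q / z\<close> and reduces the negative indices to these.\<close>

lemma summable_on_int_theta_term:
  assumes "norm Q < 1" "Q \<noteq> 0" "z \<noteq> 0"
  shows "(\<lambda>r. norm (theta_term z Q r)) summable_on UNIV"
proof -
  have nat: "summable (\<lambda>n. norm (theta_term w Q (int n)))" if w: "w \<noteq> 0" for w
  proof -
    have "(\<lambda>n. norm w * norm Q ^ n) \<longlonglongrightarrow> norm w * 0"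
      using assms by (intro tendsto_intros LIMSEQ_power_zero) auto
    hence "\<forall>\<^sub>F n in sequentially. norm w * norm Q ^ n < 1 / 2"
      by (intro order_tendstoD(2)[where y = "norm w * 0"]) auto
    then obtain N where N: "\<And>n. n \<ge> N \<Longrightarrow> norm w * norm Q ^ n \<le> 1 / 2"
      by (force simp: eventually_sequentially)
    show ?thesis
    proof (rule summable_ratio_test[where c = "1 / 2" and N = N])
      fix n assume "n \<ge> N"
      have "theta_term w Q (int (Suc n)) = - (w * Q ^ n) * theta_term w Q (int n)"
        using theta_term_Suc[OF assms(2) w, of "int n"] by (simp add: add.commute)
      hence "norm (theta_term w Q (int (Suc n))) = (norm w * norm Q ^ n) * norm (theta_term w Q (int n))"
        by (simp only: norm_mult norm_minus_cancel norm_power)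
      also have "\<dots> \<le> 1 / 2 * norm (theta_term w Q (int n))"
        by (intro mult_right_mono N \<open>n \<ge> N\<close>) auto
      finally show "norm (norm (theta_term w Q (int (Suc n)))) \<le> 1 / 2 * norm (norm (theta_term w Q (int n)))"
        by simp
    qed simp
  qed
  have 1: "(\<lambda>r. norm (theta_term w Q r)) summable_on {0..}" if "w \<noteq> 0" for w
  proof -
    have "(\<lambda>n. norm (theta_term w Q (int n))) summable_on UNIV"
      using nat[OF that] by (simp add: summable_on_UNIV_nonneg_real_iff)
    moreover have "bij_betw int UNIV {0..}"
      by (rule bij_betwI[of _ _ _ nat]) auto
    ultimately show ?thesis
      using summable_on_reindex_bij_betw[of int UNIV "{0..}"] by blast
  qed
  have "theta_term (Q / z) Q r = theta_term z Q (- r)" for r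
  proof -
    have "choose2 (- r) = choose2 r + r"
      using two_choose2[of r] two_choose2[of "-r"] by (simp add: algebra_simps)
    thus ?thesis
      using assms by (simp add: theta_term_def power_int_add power_int_minus power_int_divide_distrib field_simps)
  qed
  hence "(\<lambda>r. norm (theta_term z Q (- r))) summable_on {0..}"
    using 1[of "Q / z"] assms by simp
  hence "(\<lambda>r. norm (theta_term z Q r)) summable_on {..0}"
    by (subst (asm) summable_on_reindex_bij_witness[of _ uminus uminus "{..0}" "\<lambda>r. norm (theta_term z Q r)"]) auto
  hence "(\<lambda>r. norm (theta_term z Q r)) summable_on ({..0} \<union> ({0..} - {..0}))"
    using 1[OF assms(3)] by (intro summable_on_Un_disjoint) (auto intro: summable_on_subset_banach)
  thus ?thesis
    by (simp add: Un_Diff_cancel) (metis UNIV_I Un_iff atLeast_iff atMost_iff linorder_linear subsetI subset_UNIV subset_antisym)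
qed

text \<open>Tannery's theorem for unordered sums over any index set: it allows the number of factors to
  tend to infinity in a finite product formula whose expansion is indexed by the integers.\<close>

lemma tendsto_infsum_dominated:
  fixes f :: "nat \<Rightarrow> 'a \<Rightarrow> complex"
  assumes "\<And>k. (\<lambda>n. f n k) \<longlonglongrightarrow> g k" "\<And>n k. norm (f n k) \<le> M k" "M summable_on A"
  shows "(\<lambda>n. infsum (f n) A) \<longlonglongrightarrow> infsum g A" "g summable_on A"
proof -
  have g_le: "norm (g k) \<le> M k" for k
    by (rule Lim_norm_ubound[OF _ assms(1)]) (use assms(2) in auto)
  have "(\<lambda>k. norm (g k)) summable_on A"
    by (rule Infinite_Sum.abs_summable_on_comparison_test'[OF assms(3)]) (use g_le in auto)
  thus sg: "g summable_on A"
    by (rule abs_summable_summable)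
  have "uniform_limit UNIV (\<lambda>X n. \<Sum>k\<in>X. f n k) (\<lambda>n. infsum (f n) A) (finite_subsets_at_top A)"
    using Weierstrass_m_test_general[of A UNIV "\<lambda>k n. f n k" M] assms by simp
  moreover have "\<forall>\<^sub>F X in finite_subsets_at_top A. (\<lambda>n. \<Sum>k\<in>X. f n k) \<longlonglongrightarrow> (\<Sum>k\<in>X. g k)"
    by (intro always_eventually allI tendsto_sum assms(1))
  ultimately show "(\<lambda>n. infsum (f n) A) \<longlonglongrightarrow> infsum g A"
    by (intro swap_uniform_limit'[where F = "finite_subsets_at_top A" and S = UNIV, OF _ infsum_tendsto[OF sg]]) auto
qed

definition qfact :: "complex \<Rightarrow> nat \<Rightarrow> complex" where
  "qfact Q n = (\<Prod>i<n. 1 - Q ^ i * Q)"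

definition qbinom :: "complex \<Rightarrow> nat \<Rightarrow> nat \<Rightarrow> complex" where
  "qbinom Q n k = (if k \<le> n then qfact Q n / (qfact Q k * qfact Q (n - k)) else 0)"

lemma qfact_Suc: "qfact Q (Suc n) = qfact Q n * (1 - Q ^ Suc n)"
  by (simp add: qfact_def mult.commute)

lemma qfact_nonzero:
  assumes "norm Q < 1"
  shows "qfact Q n \<noteq> 0"
proof -
  have "Q ^ Suc i \<noteq> 1" for i
  proof
    assume "Q ^ Suc i = 1"
    hence "norm Q ^ Suc i = 1"
      by (metis norm_one norm_power)
    moreover have "norm Q ^ Suc i < 1"
      using assms power_less_one_iff[of "norm Q" "Suc i"] by auto
    ultimately show False by simp
  qed
  thus ?thesis by (auto simp: qfact_def mult.commute)
qed

lemma qbinom_Suc_Suc: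
  assumes "norm Q < 1" "k \<le> n"
  shows "qbinom Q (Suc n) (Suc k) = qbinom Q n (Suc k) + Q ^ (n - k) * qbinom Q n k"
proof (cases "k = n")
  case True
  thus ?thesis
    using qfact_nonzero[OF assms(1), of n] qfact_nonzero[OF assms(1), of "Suc n"]
    by (simp add: qbinom_def qfact_def[of Q 0])
next
  case False
  with assms obtain d where d: "n = k + Suc d"
    by (metis less_natE le_neq_implies_less add_Suc_right)
  define A B C where "A = qfact Q n" and "B = qfact Q k" and "C = qfact Q d"
  have nz: "B \<noteq> 0" "C \<noteq> 0" "1 - Q ^ Suc k \<noteq> 0" "1 - Q ^ Suc d \<noteq> 0"
    using qfact_nonzero[OF assms(1), of k] qfact_nonzero[OF assms(1), of d]
      qfact_nonzero[OF assms(1), of "Suc k"] qfact_nonzero[OF assms(1), of "Suc d"]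
    by (auto simp: B_def C_def qfact_Suc)
  have "qbinom Q (Suc n) (Suc k) = A * (1 - Q ^ Suc d * Q ^ Suc k) / (B * (1 - Q ^ Suc k) * (C * (1 - Q ^ Suc d)))"
    by (simp add: qbinom_def d A_def B_def C_def qfact_Suc power_add mult_ac)
  moreover have "qbinom Q n (Suc k) = A / (B * (1 - Q ^ Suc k) * C)"
    by (simp add: qbinom_def d A_def B_def C_def qfact_Suc mult_ac)
  moreover have "qbinom Q n k = A / (B * (C * (1 - Q ^ Suc d)))"
    by (simp add: qbinom_def d A_def B_def C_def qfact_Suc mult_ac)
  moreover have "n - k = Suc d" using d by simp
  moreover have "A * (1 - X * Y) / (B * (1 - Y) * (C * (1 - X))) = A / (B * (1 - Y) * C) + X * (A / (B * (C * (1 - X))))"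
    if "1 - Y \<noteq> 0" "1 - X \<noteq> 0" for X Y
    using that nz(1,2) by (simp add: divide_simps) (simp add: algebra_simps)
  ultimately show ?thesis using nz(3,4) by presburger
qed

text \<open>Multiplication by the next factor \<open>1 - Q^N w\<close> acts on the coefficients by the Pascal rule
  for the q-binomial coefficients.\<close>

lemma q_binomial_theorem:
  assumes "norm Q < 1" "Q \<noteq> 0" "w \<noteq> 0"
  shows "(\<Prod>i<N. 1 - Q ^ i * w) = (\<Sum>j\<le>N. theta_term w Q (int j) * qbinom Q N j)"
proof (induction N)
  case 0
  show ?case by (simp add: theta_term_def qbinom_def qfact_def)
next
  case (Suc N)
  define t where "t = (\<lambda>j. theta_term w Q (int j))"
  define S where "S = (\<Sum>j\<le>N. t j * qbinom Q N j)"
  have b0: "qbinom Q M 0 = 1" for M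
    using qfact_nonzero[OF assms(1)] by (simp add: qbinom_def qfact_def)
  have t_Suc: "t (Suc j) = - (w * Q ^ j) * t j" for j
    using theta_term_Suc[OF assms(2,3), of "int j"] by (simp add: t_def add.commute)
  have step: "t (Suc j) * qbinom Q (Suc N) (Suc j) =
      t (Suc j) * qbinom Q N (Suc j) - w * Q ^ N * (t j * qbinom Q N j)" if "j \<le> N" for j
  proof -
    have "Q ^ j * Q ^ (N - j) = Q ^ N"
      using that by (simp flip: power_add)
    hence "t (Suc j) * (Q ^ (N - j) * qbinom Q N j) = - (w * Q ^ N * (t j * qbinom Q N j))"
      unfolding t_Suc by (metis (no_types, opaque_lifting) mult.assoc mult.commute mult_minus_left)
    thus ?thesis
      unfolding qbinom_Suc_Suc[OF assms(1) that] by (simp add: distrib_left)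
  qed
  have "(\<Sum>j\<le>Suc N. t j * qbinom Q (Suc N) j)
      = t 0 + (\<Sum>j\<le>N. t (Suc j) * qbinom Q (Suc N) (Suc j))"
    by (subst sum.atMost_Suc_shift) (simp add: b0)
  also have "\<dots> = (t 0 * qbinom Q N 0 + (\<Sum>j\<le>N. t (Suc j) * qbinom Q N (Suc j))) - w * Q ^ N * S"
    by (simp add: step sum_subtractf S_def sum_distrib_left b0)
  also have "t 0 * qbinom Q N 0 + (\<Sum>j\<le>N. t (Suc j) * qbinom Q N (Suc j)) = (\<Sum>j\<le>Suc N. t j * qbinom Q N j)"
    by (subst sum.atMost_Suc_shift) simp
  also have "\<dots> = S"
    by (simp add: S_def qbinom_def)
  also have "S - w * Q ^ N * S = (\<Prod>i<Suc N. 1 - Q ^ i * w)"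
    using Suc.IH by (simp add: S_def t_def algebra_simps)
  finally show ?case by (simp add: t_def)
qed

text \<open>The q-binomial theorem for \<open>2 n\<close> factors at \<open>w = Q^(-n) z\<close>. The upper half of the factors is
  the first product, the lower half is the second one up to the term \<open>theta_term w Q n\<close>, and
  centring the summation index at \<open>n\<close> produces the same term on the other side.\<close>

lemma finite_triple_product:
  assumes "norm Q < 1" "Q \<noteq> 0" "z \<noteq> 0"
  shows "(\<Prod>i<n. 1 - Q ^ i * z) * (\<Prod>i<n. 1 - Q ^ i * (Q / z)) =
    (\<Sum>k\<in>{-int n..int n}. theta_term z Q k * qbinom Q (2 * n) (nat (int n + k)))"
proof -
  define w where "w = Q powi (- int n) * z"
  have w: "w \<noteq> 0" using assms by (simp add: w_def)
  have tn: "theta_term w Q (int n) \<noteq> 0"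
    using assms w by (simp add: theta_term_def)
  \<comment> \<open>The factors with negative powers of \<open>Q\<close>, each rewritten by \<open>1 - c = - c (1 - 1/c)\<close>.\<close>
  have low: "(\<Prod>i<m. 1 - Q powi (int i - int m) * z) = theta_term (Q powi (- int m) * z) Q (int m) * (\<Prod>i<m. 1 - Q ^ i * (Q / z))" for m
  proof (induction m)
    case 0
    show ?case by (simp add: theta_term_def)
  next
    case (Suc m)
    have "(\<Prod>i<Suc m. 1 - Q powi (int i - int (Suc m)) * z) =
        (1 - Q powi (- int (Suc m)) * z) * (\<Prod>i<m. 1 - Q powi (int i - int m) * z)"
      by (subst prod.lessThan_Suc_shift) simp
    also have "1 - Q powi (- int (Suc m)) * z = - (Q powi (- int (Suc m)) * z) * (1 - Q ^ m * (Q / z))"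
    proof -
      define X where "X = Q powi (- int (Suc m))"
      have "X * Q ^ Suc m = 1"
        using assms unfolding X_def power_int_minus power_int_of_nat
        by (intro left_inverse) auto
      hence "X * (Q * Q ^ m) = 1" by simp
      thus ?thesis
        unfolding X_def[symmetric] using assms by (simp add: field_simps)
    qed
    also have "theta_term (Q powi (- int (Suc m)) * z) Q (int (Suc m)) =
        - (Q powi (- int (Suc m)) * z) * theta_term (Q powi (- int m) * z) Q (int m)"
    proof -
      have "theta_term (Q powi (- int (Suc m)) * z) Q (1 + int m) =
         theta_term (Q powi (- int (Suc m)) * z) Q 1 * theta_term (Q powi 1 * (Q powi (- int (Suc m)) * z)) Q (int m)"
        using assms by (intro theta_term_add) auto
      moreover have "Q powi (1 + - int (Suc m)) = Q powi 1 * Q powi (- int (Suc m))"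
        using assms by (intro power_int_add) auto
      hence "Q powi 1 * (Q powi (- int (Suc m)) * z) = Q powi (- int m) * z"
        by simp
      moreover have "theta_term (Q powi (- int (Suc m)) * z) Q 1 = - (Q powi (- int (Suc m)) * z)"
        by (simp add: theta_term_def)
      ultimately show ?thesis
        by (simp only: of_nat_Suc)
    qed
    ultimately show ?case using Suc.IH by (simp add: mult_ac)
  qed
  have "(\<Prod>i<n + n. 1 - Q ^ i * w) = (\<Prod>i<n. 1 - Q ^ i * w) * (\<Prod>i<n. 1 - Q ^ (n + i) * w)"
    by (simp only: lessThan_atLeast0 prod.atLeastLessThan_concat[of 0 n "n + n", symmetric] le0 le_add1)
       (simp add: prod.shift_bounds_nat_ivl[of _ 0 n n, simplified] add.commute)
  also have "(\<Prod>i<n. 1 - Q ^ (n + i) * w) = (\<Prod>i<n. 1 - Q ^ i * z)"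
    using assms by (intro prod.cong) (auto simp: w_def power_add power_int_minus)
  also have "(\<Prod>i<n. 1 - Q ^ i * w) = (\<Prod>i<n. 1 - Q powi (int i - int n) * z)"
    using assms by (intro prod.cong) (auto simp: w_def power_int_diff power_int_minus field_simps)
  also have "\<dots> = theta_term w Q (int n) * (\<Prod>i<n. 1 - Q ^ i * (Q / z))"
    unfolding w_def by (rule low)
  finally have 1: "theta_term w Q (int n) * ((\<Prod>i<n. 1 - Q ^ i * z) * (\<Prod>i<n. 1 - Q ^ i * (Q / z)))
     = (\<Prod>i<n + n. 1 - Q ^ i * w)" by (simp add: mult_ac)
  have "(\<Prod>i<n + n. 1 - Q ^ i * w) = (\<Sum>j\<le>2*n. theta_term w Q (int j) * qbinom Q (2 * n) j)"
    using q_binomial_theorem[OF assms(1,2) w, of "2 * n"] by (simp add: mult_2)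
  also have "\<dots> = (\<Sum>k\<in>{-int n..int n}. theta_term w Q (int n + k) * qbinom Q (2 * n) (nat (int n + k)))"
    by (rule sum.reindex_bij_witness[where i = "\<lambda>k. nat (int n + k)" and j = "\<lambda>j. int j - int n"]) auto
  also have "\<dots> = theta_term w Q (int n) *
      (\<Sum>k\<in>{-int n..int n}. theta_term z Q k * qbinom Q (2 * n) (nat (int n + k)))"
  proof -
    have "Q powi int n * w = z"
      using assms by (simp add: w_def power_int_minus)
    thus ?thesis
      unfolding theta_term_add[OF assms(2) w] by (simp add: sum_distrib_left mult.assoc)
  qed
  finally show ?thesis
    using 1 tn by simp
qed

text \<open>The Jacobi triple product. In its finite form the q-binomial coefficients are bounded and tend to
  the reciprocal of \<open>(Q;Q)\<close>, so the limit may be taken term by term.\<close>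

theorem theta_term_has_sum:
  assumes "norm Q < 1" "Q \<noteq> 0" "z \<noteq> 0"
  shows "(theta_term z Q has_sum Theta z Q) UNIV"
proof -
  define J where "J = qpochhammer_inf Q Q"
  have J: "J \<noteq> 0" unfolding J_def by (rule qpochhammer_inf_self_nonzero[OF assms(1)])
  have qfact_lim: "qfact Q \<longlonglongrightarrow> J"
    unfolding qfact_def J_def by (rule qpochhammer_inf_tendsto[OF assms(1)])
  obtain B where B: "\<And>n. norm (qfact Q n) \<le> B"
    using convergent_imp_Bseq[of "qfact Q"] qfact_lim by (auto simp: Bseq_def convergent_def)
  have "(\<lambda>n. inverse (qfact Q n)) \<longlonglongrightarrow> inverse J"
    by (intro tendsto_intros qfact_lim J)
  then obtain C where C: "\<And>n. norm (inverse (qfact Q n)) \<le> C"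
    using convergent_imp_Bseq[of "\<lambda>n. inverse (qfact Q n)"] by (auto simp: Bseq_def convergent_def)
  have B0: "0 \<le> B" and C0: "0 \<le> C" using B[of 0] C[of 0] norm_ge_zero order_trans by blast+
  have bin_le: "norm (qbinom Q n k) \<le> B * (C * C)" for n k
  proof (cases "k \<le> n")
    case True
    hence "norm (qbinom Q n k) = norm (qfact Q n) * (norm (inverse (qfact Q k)) * norm (inverse (qfact Q (n - k))))"
      by (simp add: qbinom_def norm_divide norm_mult norm_inverse field_simps)
    also have "\<dots> \<le> B * (C * C)"
      by (intro mult_mono B C) (use B0 C0 in auto)
    finally show ?thesis .
  qed (use B0 C0 in \<open>auto simp: qbinom_def\<close>)
  define f where "f = (\<lambda>n k. if \<bar>k\<bar> \<le> int n then theta_term z Q k * qbinom Q (2 * n) (nat (int n + k)) else 0)"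
  have f_infsum: "infsum (f n) UNIV = (\<Prod>i<n. 1 - Q ^ i * z) * (\<Prod>i<n. 1 - Q ^ i * (Q / z))" for n
  proof -
    have "infsum (f n) UNIV = infsum (\<lambda>k. theta_term z Q k * qbinom Q (2 * n) (nat (int n + k))) {-int n..int n}"
      by (rule infsum_cong_neutral) (auto simp: f_def)
    thus ?thesis using finite_triple_product[OF assms, of n] by simp
  qed
  have f_lim: "(\<lambda>n. f n k) \<longlonglongrightarrow> theta_term z Q k * inverse J" for k
  proof -
    have "filterlim (\<lambda>n. nat (int n + k)) at_top sequentially" "filterlim (\<lambda>n. nat (int n - k)) at_top sequentially"
      "filterlim (\<lambda>n. 2 * n) at_top (sequentially :: nat filter)"
    proof -
      show "filterlim (\<lambda>n. nat (int n + k)) at_top sequentially"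
        unfolding filterlim_at_top eventually_sequentially
        by (intro allI, rule_tac x = "nat (int Z + \<bar>k\<bar>)" in exI) linarith
      show "filterlim (\<lambda>n. nat (int n - k)) at_top sequentially"
        unfolding filterlim_at_top eventually_sequentially
        by (intro allI, rule_tac x = "nat (int Z + \<bar>k\<bar>)" in exI) linarith
      show "filterlim (\<lambda>n. 2 * n) at_top (sequentially :: nat filter)"
        by (rule filterlim_subseq) (simp add: strict_mono_def)
    qed
    note lims = filterlim_compose[OF qfact_lim this(1)] filterlim_compose[OF qfact_lim this(2)]
      filterlim_compose[OF qfact_lim this(3)]
    have "(\<lambda>n. theta_term z Q k * (qfact Q (2 * n) / (qfact Q (nat (int n + k)) * qfact Q (nat (int n - k)))))
        \<longlonglongrightarrow> theta_term z Q k * (J / (J * J))"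
      using J by (intro tendsto_intros lims) auto
    moreover have "\<forall>\<^sub>F n in sequentially. theta_term z Q k * (qfact Q (2 * n) / (qfact Q (nat (int n + k)) * qfact Q (nat (int n - k)))) = f n k"
    proof (rule eventually_mono[OF eventually_ge_at_top[of "nat \<bar>k\<bar>"]])
      fix n assume n: "nat \<bar>k\<bar> \<le> n"
      have "2 * n - nat (int n + k) = nat (int n - k)" "nat (int n + k) \<le> 2 * n" "\<bar>k\<bar> \<le> int n"
        using n by linarith+
      thus "theta_term z Q k * (qfact Q (2 * n) / (qfact Q (nat (int n + k)) * qfact Q (nat (int n - k)))) = f n k"
        by (simp add: f_def qbinom_def)
    qed
    ultimately have "(\<lambda>n. f n k) \<longlonglongrightarrow> theta_term z Q k * (J / (J * J))"
      by (rule Lim_transform_eventually)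
    moreover have "J / (J * J) = inverse J" using J by (simp add: field_simps)
    ultimately show ?thesis by simp
  qed
  note dom = tendsto_infsum_dominated[where f = f and A = UNIV
      and g = "\<lambda>k. theta_term z Q k * inverse J" and M = "\<lambda>k. norm (theta_term z Q k) * (B * (C * C))", OF f_lim]
  have le: "norm (f n k) \<le> norm (theta_term z Q k) * (B * (C * C))" for n k
    using B0 C0 by (auto simp: f_def norm_mult intro!: mult_left_mono bin_le)
  have sm: "(\<lambda>k. norm (theta_term z Q k) * (B * (C * C))) summable_on UNIV"
    by (intro summable_on_cmult_left summable_on_int_theta_term assms)
  have "(\<lambda>n. (\<Prod>i<n. 1 - Q ^ i * z) * (\<Prod>i<n. 1 - Q ^ i * (Q / z)))
      \<longlonglongrightarrow> infsum (\<lambda>k. theta_term z Q k * inverse J) UNIV"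
    using dom(1)[OF le sm] by (simp add: f_infsum)
  moreover have "(\<lambda>n. (\<Prod>i<n. 1 - Q ^ i * z) * (\<Prod>i<n. 1 - Q ^ i * (Q / z)))
      \<longlonglongrightarrow> qpochhammer_inf z Q * qpochhammer_inf (Q / z) Q"
    by (intro tendsto_intros qpochhammer_inf_tendsto assms)
  ultimately have "infsum (\<lambda>k. theta_term z Q k * inverse J) UNIV = qpochhammer_inf z Q * qpochhammer_inf (Q / z) Q"
    by (rule LIMSEQ_unique)
  hence "((\<lambda>k. theta_term z Q k * inverse J) has_sum (qpochhammer_inf z Q * qpochhammer_inf (Q / z) Q)) UNIV"
    using dom(2)[OF le sm] has_sum_infsum by fastforce
  from has_sum_cmult_left[OF this, of J]
  have "((\<lambda>k. theta_term z Q k * inverse J * J) has_sum Theta z Q) UNIV"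
    by (simp add: Theta_def J_def)
  moreover have "theta_term z Q k * inverse J * J = theta_term z Q k" for k
    using J by simp
  ultimately show ?thesis by simp
qed

section \<open>Quasi-periodic functions on the punctured plane\<close>

text \<open>Every orbit under multiplication by \<open>q\<close> meets the compact annulus \<open>|q| \<le> |x| \<le> 1\<close>, so
  \<open>p (exp w)\<close> is a bounded entire function and Liouville's theorem applies.\<close>

lemma elliptic_constant:
  assumes q: "q \<noteq> 0" "norm q < 1"
    and hol: "p holomorphic_on - {0}"
    and per: "\<And>x. x \<noteq> 0 \<Longrightarrow> p (q * x) = p x"
    and "x \<noteq> 0" "y \<noteq> 0"
  shows "p x = p (y :: complex)"
proof -
  have per_nat: "p (q ^ n * x) = p x" if "x \<noteq> 0" for n x
    using that by (induction n) (use q per in \<open>auto simp: mult.assoc\<close>)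
  have per_int: "p (q powi k * x) = p x" if "x \<noteq> 0" for k x
  proof (cases "k \<ge> 0")
    case True
    thus ?thesis using per_nat[OF that, of "nat k"] by (simp add: power_int_def)
  next
    case False
    have "q powi (- k) * (q powi k * x) = x"
      using q by (simp add: power_int_minus)
    moreover have "q powi (- k) = q ^ nat (- k)"
      using False by (simp add: power_int_def)
    ultimately have *: "q ^ nat (- k) * (q powi k * x) = x"
      by simp
    have "p (q ^ nat (- k) * (q powi k * x)) = p (q powi k * x)"
      by (rule per_nat) (use that q in auto)
    thus ?thesis unfolding * by (rule sym)
  qed
  define A where "A = {x :: complex. norm q \<le> norm x} \<inter> cball 0 1"
  have "compact A"
    unfolding A_def by (intro closed_Int_compact closed_Collect_le continuous_intros) auto
  moreover have "continuous_on A p"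
    by (rule holomorphic_on_imp_continuous_on, rule holomorphic_on_subset[OF hol])
       (use q in \<open>auto simp: A_def\<close>)
  ultimately have "bounded (p ` A)"
    using compact_continuous_image compact_imp_bounded by blast
  moreover have "range (p \<circ> exp) \<subseteq> p ` A"
  proof (clarsimp)
    fix w :: complex
    define a where "a = ln (norm q)"
    have a: "a < 0" using q by (simp add: a_def)
    \<comment> \<open>This power of \<open>q\<close> moves \<open>exp w\<close> into the annulus.\<close>
    define k where "k = \<lceil>- (Re w / a)\<rceil>"
    have norm_eq: "norm (q powi k * exp w) = exp (a * of_int k + Re w)"
    proof -
      have "norm q powi k = exp a powi k"
        using q by (simp add: a_def)
      also have "\<dots> = exp (a * of_int k)"
        by (simp add: exp_power_int mult.commute)
      finally show ?thesis
        by (simp add: norm_mult norm_power_int exp_add)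
    qed
    have "- (Re w / a) \<le> of_int k" "of_int k \<le> - (Re w / a) + 1"
      unfolding k_def by linarith+
    hence "a * of_int k \<le> a * (- (Re w / a))" "a * (- (Re w / a) + 1) \<le> a * of_int k"
      using a by (simp_all only: mult_left_mono_neg less_imp_le)
    moreover have "a * (- (Re w / a)) = - Re w" "a * (- (Re w / a) + 1) = a - Re w"
      using a by (simp_all add: field_simps)
    ultimately have le: "a * of_int k + Re w \<le> 0" "a \<le> a * of_int k + Re w"
      by linarith+
    have "norm q = exp a" using q by (simp add: a_def)
    hence "q powi k * exp w \<in> A"
      using le by (simp add: A_def norm_eq)
    thus "p (exp w) \<in> p ` A"
      using per_int[of "exp w" k] by (metis exp_not_eq_zero imageI)
  qed
  ultimately have bdd: "bounded (range (p \<circ> exp))"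
    by (rule bounded_subset)
  have "(p \<circ> exp) holomorphic_on UNIV"
    by (rule holomorphic_on_compose_gen[OF holomorphic_on_exp hol]) auto
  from Liouville_theorem[OF this bdd] obtain c where "\<And>w. (p \<circ> exp) w = c"
    by (auto simp: constant_on_def)
  hence "p (exp w) = c" for w by simp
  hence "p (exp (Ln x)) = p (exp (Ln y))" by simp
  thus ?thesis using \<open>x \<noteq> 0\<close> \<open>y \<noteq> 0\<close> by simp
qed

text \<open>Suppose \<open>h a \<noteq> 0\<close>. The function \<open>h x * h (a^2 / x)\<close> is invariant under \<open>x \<mapsto> q x\<close>, hence a
  nonzero constant, so \<open>h\<close> has no zeros. Then \<open>x h'(x) / h x\<close> is holomorphic and invariant, hence a
  constant \<open>K\<close>, and \<open>h (exp w) = h 1 * exp (K w)\<close>. As \<open>h\<close> is single-valued, \<open>K\<close> is an integer \<open>n\<close>, and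
  the multiplier of \<open>h\<close> is \<open>q^n\<close>.\<close>

lemma quasi_periodic_eq_0:
  assumes q: "q \<noteq> 0" "norm q < 1"
    and hol: "h holomorphic_on - {0}"
    and per: "\<And>x. x \<noteq> 0 \<Longrightarrow> h (q * x) = \<mu> * h x"
    and \<mu>: "\<mu> \<noteq> 0" "\<And>k::int. \<mu> \<noteq> q powi k"
    and "a \<noteq> 0"
  shows "h a = (0 :: complex)"
proof (rule ccontr)
  assume ha: "h a \<noteq> 0"
  have nz: "h b \<noteq> 0" if b: "b \<noteq> 0" for b
  proof -
    define p where "p = (\<lambda>x. h x * h (a\<^sup>2 / x))"
    have "p a = p b"
    proof (rule elliptic_constant[OF q _ _ \<open>a \<noteq> 0\<close> b])
      have "(\<lambda>x. h (a\<^sup>2 / x)) holomorphic_on - {0}"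
        by (rule holomorphic_on_compose_gen[OF _ hol, of "\<lambda>x. a\<^sup>2 / x", unfolded o_def])
           (use \<open>a \<noteq> 0\<close> in \<open>auto intro!: holomorphic_intros\<close>)
      thus "p holomorphic_on - {0}"
        unfolding p_def by (intro holomorphic_intros hol)
      show "p (q * x) = p x" if "x \<noteq> 0" for x
        using per[OF that] per[of "a\<^sup>2 / (q * x)"] that q \<open>a \<noteq> 0\<close>
        by (simp add: p_def)
    qed
    moreover have "p a = h a * h a"
      using \<open>a \<noteq> 0\<close> by (simp add: p_def power2_eq_square)
    ultimately show ?thesis using ha by (auto simp: p_def)
  qed
  define L where "L = (\<lambda>x. x * deriv h x / h x)"
  have holD: "deriv h holomorphic_on - {0}"
    by (rule holomorphic_deriv[OF hol]) auto
  have dh: "(h has_field_derivative deriv h x) (at x)" if "x \<noteq> 0" for x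
    by (rule holomorphic_derivI[OF hol]) (use that in auto)
  have "L x = L 1" if x: "x \<noteq> 0" for x
  proof (rule elliptic_constant[OF q _ _ x])
    show "L holomorphic_on - {0}"
      unfolding L_def by (intro holomorphic_intros hol holD) (use nz in auto)
    show "L (q * x) = L x" if "x \<noteq> 0" for x
    proof -
      have "((\<lambda>x. h (q * x)) has_field_derivative deriv h (q * x) * q) (at x)"
        by (rule DERIV_chain2[OF dh]) (use that q in \<open>auto intro!: derivative_eq_intros\<close>)
      moreover have "((\<lambda>x. \<mu> * h x) has_field_derivative \<mu> * deriv h x) (at x)"
        by (rule DERIV_cmult[OF dh[OF that]])
      moreover have "eventually (\<lambda>x. h (q * x) = \<mu> * h x) (nhds x)"
        by (rule eventually_mono[OF eventually_nhds_in_open[of "- {0}"]]) (use that per in auto)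
      ultimately have "deriv h (q * x) * q = \<mu> * deriv h x"
        using DERIV_cong_ev[of x x "\<lambda>x. h (q * x)" "\<lambda>x. \<mu> * h x"] DERIV_unique by blast
      hence "q * deriv h (q * x) = \<mu> * deriv h x" by (simp add: mult.commute)
      hence "q * x * deriv h (q * x) = x * (\<mu> * deriv h x)"
        by (simp only: mult.assoc mult.left_commute[of q x])
      hence "L (q * x) = x * (\<mu> * deriv h x) / (\<mu> * h x)"
        unfolding L_def per[OF that] by (rule arg_cong)
      thus ?thesis using \<mu> by (simp add: L_def)
    qed
  qed auto
  note L_const = this
  define K where "K = L 1"
  have dh': "deriv h x * x = K * h x" if "x \<noteq> 0" for x
  proof -
    have "x * deriv h x / h x = K"
      using L_const[OF that] unfolding K_def L_def .
    thus ?thesis using nz[OF that] by (simp add: divide_eq_eq mult.commute)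
  qed
  have "((\<lambda>w. h (exp w) * exp (- (K * w))) has_field_derivative 0) (at w)" for w
  proof -
    have "((\<lambda>w. h (exp w)) has_field_derivative deriv h (exp w) * exp w) (at w)"
      by (rule DERIV_chain2[OF dh]) (auto intro!: derivative_eq_intros)
    hence "((\<lambda>w. h (exp w)) has_field_derivative K * h (exp w)) (at w)"
      by (simp add: dh' K_def)
    hence "((\<lambda>w. h (exp w) * exp (- (K * w))) has_field_derivative
        K * h (exp w) * exp (- (K * w)) + exp (- (K * w)) * - K * h (exp w)) (at w)"
      by (rule DERIV_mult) (auto intro!: derivative_eq_intros)
    thus ?thesis by (simp add: mult_ac)
  qed
  then obtain c where "h (exp w) * exp (- (K * w)) = c" for w
    using has_field_derivative_zero_constant[of UNIV "\<lambda>w. h (exp w) * exp (- (K * w))"] by auto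
  hence "h (exp w) * exp (- (K * w)) = h (exp 0) * exp (- (K * 0))" for w
    by metis
  hence main: "h (exp w) = h 1 * exp (K * w)" for w
    by (simp add: exp_minus field_simps)
  have "exp (K * (2 * of_real pi * \<i>)) = 1"
    using main[of "2 * of_real pi * \<i>"] nz[of 1] by simp
  then obtain n :: int where "Im (K * (2 * of_real pi * \<i>)) = of_int (2 * n) * pi" "Re (K * (2 * of_real pi * \<i>)) = 0"
    by (subst (asm) exp_eq_1) blast
  hence K: "K = of_int n"
    by (simp add: complex_eq_iff)
  have "h q = h 1 * q powi n"
    using main[of "Ln q"] q exp_power_int[of "Ln q" n] by (simp add: K mult.commute)
  moreover have "h q = \<mu> * h 1"
    using per[of 1] by simp
  ultimately show False using \<mu>(2)[of n] nz[of 1] by simp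
qed

text \<open>The same conclusion for a function that is given only off a discrete set \<open>P\<close>. Limits at the
  points of \<open>P\<close> are required at one point of each orbit under \<open>x \<mapsto> q x\<close>; the functional equation
  carries them to the whole orbit.\<close>

lemma quasi_periodic_removable_eq_0:
  assumes q: "q \<noteq> 0" "norm q < 1"
    and \<mu>: "\<mu> \<noteq> 0" "\<And>k::int. \<mu> \<noteq> q powi k"
    and isolated: "\<And>p. p \<noteq> 0 \<Longrightarrow> \<forall>\<^sub>F x in at p. x \<notin> P"
    and analytic: "h analytic_on - {0} - P"
    and per: "\<And>x. x \<noteq> 0 \<Longrightarrow> x \<notin> P \<Longrightarrow> h (q * x) = \<mu> * h x"
    and lim: "\<And>p. p \<noteq> 0 \<Longrightarrow> p \<in> P \<Longrightarrow> \<exists>(k :: int) l. (h \<longlongrightarrow> l) (at (q powi k * p))"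
    and x: "x \<noteq> 0" "x \<notin> P"
  shows "h x = (0 :: complex)"
proof -
  define g where "g = remove_sings h"
  have an: "h analytic_on {p}" if "p \<noteq> 0" "p \<notin> P" for p
    by (rule analytic_on_subset[OF analytic]) (use that in auto)
  have g_eq: "g p = h p" if "p \<noteq> 0" "p \<notin> P" for p
    unfolding g_def by (rule remove_sings_at_analytic[OF an[OF that]])
  have ev: "\<forall>\<^sub>F x in at p. x \<noteq> 0 \<and> x \<notin> P" if "p \<noteq> 0" for p
    using isolated[OF that] that
    by (intro eventually_conj) (auto intro: eventually_neq_at_within)
  have scale: "filterlim (\<lambda>x. c * x) (at (c * p)) (at p)" if "c \<noteq> 0" for c p :: complex
    using that by (intro filterlim_atI tendsto_intros) (auto simp: eventually_at_filter)
  have step: "(\<exists>l. (h \<longlongrightarrow> l) (at (q * p))) \<longleftrightarrow> (\<exists>l. (h \<longlongrightarrow> l) (at p))" if p: "p \<noteq> 0" for p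
  proof safe
    fix l assume "(h \<longlongrightarrow> l) (at (q * p))"
    hence "((\<lambda>x. h (q * x)) \<longlongrightarrow> l) (at p)"
      by (rule filterlim_compose[OF _ scale[OF q(1)]])
    hence "((\<lambda>x. h (q * x) / \<mu>) \<longlongrightarrow> l / \<mu>) (at p)"
      using \<mu> by (intro tendsto_intros)
    moreover have "\<forall>\<^sub>F x in at p. h (q * x) / \<mu> = h x"
      using ev[OF p] by eventually_elim (use per \<mu> in simp)
    ultimately have "(h \<longlongrightarrow> l / \<mu>) (at p)" by (rule Lim_transform_eventually)
    thus "\<exists>l. (h \<longlongrightarrow> l) (at p)" by blast
  next
    fix l assume *: "(h \<longlongrightarrow> l) (at p)"
    have sc: "filterlim (\<lambda>x. 1 / q * x) (at p) (at (q * p))"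
      using scale[of "1 / q" "q * p"] q by simp
    have "((\<lambda>x. \<mu> * h (1 / q * x)) \<longlongrightarrow> \<mu> * l) (at (q * p))"
      by (rule tendsto_mult_left[OF filterlim_compose[OF * sc]])
    moreover have "\<forall>\<^sub>F x in at (q * p). \<mu> * h (1 / q * x) = h x"
      using eventually_compose_filterlim[OF ev[OF p] sc]
    proof eventually_elim
      case (elim x)
      thus ?case using per[of "1 / q * x"] q by simp
    qed
    ultimately have "(h \<longlongrightarrow> \<mu> * l) (at (q * p))" by (rule Lim_transform_eventually)
    thus "\<exists>l. (h \<longlongrightarrow> l) (at (q * p))" by blast
  qed
  have steps: "(\<exists>l. (h \<longlongrightarrow> l) (at (q powi k * p))) \<longleftrightarrow> (\<exists>l. (h \<longlongrightarrow> l) (at p))" if p: "p \<noteq> 0" for k p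
  proof (induction k rule: int_induct[where k = 0])
    case base
    show ?case by simp
  next
    case (step1 i)
    have "q powi (i + 1) * p = q * (q powi i * p)"
      using q by (simp add: power_int_add)
    thus ?case using step[of "q powi i * p"] step1 p q by (simp add: mult.assoc)
  next
    case (step2 i)
    have "q powi i * p = q * (q powi (i - 1) * p)"
      using q by (simp add: power_int_diff)
    thus ?case using step[of "q powi (i - 1) * p"] step2 p q by (simp add: mult.assoc)
  qed
  have g_an: "g analytic_on {p}" if p: "p \<noteq> 0" for p
  proof -
    obtain l where l: "(h \<longlongrightarrow> l) (at p)"
      using lim[OF p] steps[OF p] isContD[OF analytic_at_imp_isCont[OF an[OF p]]] by metis
    obtain r where r: "r > 0" "\<And>x. x \<in> ball p r \<Longrightarrow> x \<noteq> p \<Longrightarrow> x \<noteq> 0 \<and> x \<notin> P"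
      using ev[OF p] unfolding eventually_at by (auto simp: dist_commute)
    have "ball p r - {p} \<subseteq> - {0} - P" using r(2) by blast
    with analytic have "h analytic_on ball p r - {p}" by (rule analytic_on_subset)
    hence "isolated_singularity_at h p"
      unfolding isolated_singularity_at_def using r(1) by (intro exI[of _ r] conjI)
    thus ?thesis unfolding g_def by (rule remove_sings_analytic_at[OF _ l])
  qed
  have "g x = 0"
  proof (rule quasi_periodic_eq_0[OF q _ _ \<mu> x(1)])
    show "g holomorphic_on - {0}"
      by (rule analytic_imp_holomorphic, subst analytic_on_analytic_at) (use g_an in simp)
    show "g (q * x) = \<mu> * g x" if "x \<noteq> 0" for x
    proof -
      have cont: "(g \<longlongrightarrow> g y) (at y)" if "y \<noteq> 0" for y
        using analytic_at_imp_isCont[OF g_an[OF that]] by (rule isContD)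
      have lim1: "((\<lambda>x. g (q * x)) \<longlongrightarrow> g (q * x)) (at x)"
        by (rule isCont_tendsto_compose[OF analytic_at_imp_isCont[OF g_an]])
           (use q that in \<open>auto intro: tendsto_intros\<close>)
      have lim2: "((\<lambda>x. \<mu> * g x) \<longlongrightarrow> \<mu> * g x) (at x)"
        by (rule tendsto_mult_left[OF cont[OF that]])
      have "\<forall>\<^sub>F x in at x. q * x \<noteq> 0 \<and> q * x \<notin> P"
        by (rule eventually_compose_filterlim[OF ev scale[OF q(1)]]) (use that q in simp)
      hence "\<forall>\<^sub>F x in at x. g (q * x) = \<mu> * g x"
        using ev[OF that] by eventually_elim (auto simp: g_eq per)
      hence "((\<lambda>x. \<mu> * g x) \<longlongrightarrow> g (q * x)) (at x)"
        by (rule Lim_transform_eventually[OF lim1])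
      from tendsto_unique[OF trivial_limit_at this lim2] show ?thesis .
    qed
  qed
  thus ?thesis using g_eq[OF x] by simp
qed

section \<open>Appell series as meromorphic functions\<close>

lemma powi_eq_powi_iff:
  fixes Q :: complex
  assumes "norm Q < 1" "Q \<noteq> 0"
  shows "Q powi a = Q powi b \<longleftrightarrow> a = b"
proof
  assume *: "Q powi a = Q powi b"
  show "a = b"
  proof (rule ccontr)
    assume "a \<noteq> b"
    hence "norm Q powi a \<noteq> norm Q powi b"
      using power_int_strict_decreasing[of a b "norm Q"] power_int_strict_decreasing[of b a "norm Q"] assms
      by (cases a b rule: linorder_cases) auto
    thus False using * by (metis norm_power_int)
  qed
qed auto

lemma eq_powi_minusI: "Q powi k * y = 1 \<Longrightarrow> y = (Q :: complex) powi (- k)"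
  by (simp only: power_int_minus) (metis inverse_unique)

text \<open>The zeros are isolated because the function does not vanish identically: the only integral power
  of \<open>Q\<close> with modulus 1 is 1, so \<open>-1\<close> is not a zero.\<close>

lemma eventually_Theta_nonzero:
  assumes "norm Q < 1" "Q \<noteq> 0" "p \<noteq> 0"
  shows "\<forall>\<^sub>F y in at p. Theta y Q \<noteq> 0 \<and> y \<noteq> 0"
proof -
  have "Theta (-1) Q \<noteq> 0"
  proof
    assume "Theta (-1) Q = 0"
    then obtain k where k: "-1 = Q powi k"
      using assms by (auto simp: Theta_eq_0_iff)
    hence "Q powi (k + k) = Q powi 0"
      using assms by (subst power_int_add) (auto simp flip: k)
    hence "k = 0" using assms by (subst (asm) powi_eq_powi_iff) auto
    thus False using k by simp
  qed
  moreover have "connected (- {0 :: complex})"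
    by (intro connected_punctured_universe) auto
  moreover have "(\<lambda>y. Theta y Q) holomorphic_on - {0}"
    by (rule analytic_imp_holomorphic, rule Theta_analytic) (use assms in auto)
  ultimately have "\<forall>\<^sub>F y in at p. Theta y Q \<noteq> 0 \<and> y \<in> - {0}"
    using assms by (intro non_zero_neighbour_alt[where \<beta> = "-1"]) auto
  thus ?thesis by simp
qed

text \<open>The bilateral series in the numerator of the Appell function, in the variable \<open>y = x z\<close>. The index
  set is a parameter so that a singular term can be split off.\<close>

definition appell_series :: "int set \<Rightarrow> complex \<Rightarrow> complex \<Rightarrow> complex \<Rightarrow> complex" where
  "appell_series I z Q y = (\<Sum>\<^sub>\<infinity>r\<in>I. theta_term z Q r / (1 - Q powi (r - 1) * y))"

lemma appell_m_eq_series: "appell_m x z Q = appell_series UNIV z Q (x * z) / Theta z Q"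
  by (simp add: appell_m_def appell_series_def theta_term_def choose2_def mult.assoc)

text \<open>On a compact set that avoids 0, the numbers \<open>Q^(r-1) y\<close> are uniformly close to 0 for large \<open>r\<close>
  and uniformly large for large \<open>-r\<close>. This leaves finitely many indices, for which the compactness
  of \<open>K\<close> suffices.\<close>

lemma appell_denominator_bound:
  fixes Q :: complex
  assumes Q: "norm Q < 1" "Q \<noteq> 0"
    and K: "compact K" "0 \<notin> K"
    and nz: "\<And>r y. r \<in> I \<Longrightarrow> y \<in> K \<Longrightarrow> Q powi (r - 1) * y \<noteq> 1"
  obtains \<delta> where "\<delta> > 0" "\<And>r y. r \<in> I \<Longrightarrow> y \<in> K \<Longrightarrow> \<delta> \<le> norm (1 - Q powi (r - 1) * y)"
proof (cases "K = {}")
  case True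
  thus ?thesis using that[of 1] by auto
next
  case False
  obtain M where M: "\<And>y. y \<in> K \<Longrightarrow> norm y \<le> M"
    using compact_imp_bounded[OF K(1)] by (auto simp: bounded_iff)
  obtain m where m: "m > 0" "\<And>y. y \<in> K \<Longrightarrow> m \<le> norm y"
  proof -
    obtain y0 where "y0 \<in> K" "\<And>y. y \<in> K \<Longrightarrow> norm y0 \<le> norm y"
      using continuous_attains_inf[OF K(1) False, of norm] by (auto intro: continuous_intros)
    thus ?thesis using that[of "norm y0"] K(2) by fastforce
  qed
  have "(\<lambda>n. norm Q ^ n) \<longlonglongrightarrow> 0"
    using Q by (intro LIMSEQ_power_zero) auto
  moreover from this have "(\<lambda>n. norm Q ^ n * M) \<longlonglongrightarrow> 0"
    by (rule tendsto_mult_left_zero)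
  ultimately have "\<forall>\<^sub>F n in sequentially. norm Q ^ n * M < 1 / 2 \<and> norm Q ^ n < m / 2"
    using m by (intro eventually_conj order_tendstoD(2)[of _ 0]) auto
  then obtain N where N: "norm Q ^ N * M < 1 / 2" "norm Q ^ N < m / 2"
    by (auto simp: eventually_sequentially)
  \<comment> \<open>Beyond \<open>N\<close> the number \<open>Q^s y\<close> has modulus below 1/2 or above 2.\<close>
  have far: "1 / 2 \<le> norm (1 - Q powi s * y)" if y: "y \<in> K" and s: "\<bar>s\<bar> \<ge> int N" for s y
  proof (cases "s \<ge> 0")
    case True
    have "norm (Q powi s * y) = norm Q powi s * norm y"
      by (simp add: norm_mult norm_power_int)
    also have "\<dots> \<le> norm Q powi int N * M"
      using True s Q M[OF y] by (intro mult_mono power_int_decreasing) auto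
    also have "\<dots> < 1 / 2" using N by simp
    finally show ?thesis
      using norm_triangle_ineq2[of 1 "Q powi s * y"] by simp
  next
    case False
    have "norm Q powi (- s) \<le> norm Q powi int N"
      using False s Q by (intro power_int_decreasing) auto
    also have "\<dots> < m / 2" using N by simp
    also have "\<dots> \<le> norm y / 2" using m(2)[OF y] by simp
    finally have "2 * norm Q powi (- s) < norm y" by simp
    hence "2 < norm Q powi s * norm y"
      using Q by (simp add: power_int_minus field_simps)
    hence "2 < norm (Q powi s * y)"
      by (simp add: norm_mult norm_power_int)
    thus ?thesis
      using norm_triangle_ineq2[of "Q powi s * y" 1] by (simp add: norm_minus_commute)
  qed
  have "\<exists>\<delta>>0. \<forall>y\<in>K. \<delta> \<le> norm (1 - Q powi (r - 1) * y)" if r: "r \<in> I" for r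
  proof -
    obtain y0 where "y0 \<in> K" "\<And>y. y \<in> K \<Longrightarrow> norm (1 - Q powi (r - 1) * y0) \<le> norm (1 - Q powi (r - 1) * y)"
    proof -
      have "continuous_on K (\<lambda>y. norm (1 - Q powi (r - 1) * y))"
        by (intro continuous_intros)
      from continuous_attains_inf[OF K(1) False this] show ?thesis using that by blast
    qed
    thus ?thesis using nz[OF r, of y0] by (intro exI[of _ "norm (1 - Q powi (r - 1) * y0)"]) auto
  qed
  then obtain d where d: "\<And>r. r \<in> I \<Longrightarrow> d r > 0" "\<And>r y. r \<in> I \<Longrightarrow> y \<in> K \<Longrightarrow> d r \<le> norm (1 - Q powi (r - 1) * y)"
    by metis
  define D where "D = insert (1 / 2) (d ` (I \<inter> {1 - int N..1 + int N}))"
  have D: "finite D" "D \<noteq> {}" by (auto simp: D_def)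
  show ?thesis
  proof (rule that[of "Min D"])
    show "Min D > 0" using D d(1) by (auto simp: D_def)
    fix r y assume r: "r \<in> I" and y: "y \<in> K"
    show "Min D \<le> norm (1 - Q powi (r - 1) * y)"
    proof (cases "\<bar>r - 1\<bar> \<ge> int N")
      case True
      have "Min D \<le> 1 / 2" using D by (intro Min_le) (auto simp: D_def)
      thus ?thesis using far[OF y True] by linarith
    next
      case False
      hence "r \<in> I \<inter> {1 - int N..1 + int N}" using r by auto
      hence "Min D \<le> d r" using D(1) by (intro Min_le) (simp_all add: D_def)
      thus ?thesis using d(2)[OF r y] by linarith
    qed
  qed
qed

lemma appell_series_summable:
  assumes Q: "norm Q < 1" "Q \<noteq> 0" and "z \<noteq> 0" "y \<noteq> 0"
    and nz: "\<And>r. r \<in> I \<Longrightarrow> Q powi (r - 1) * y \<noteq> 1"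
  shows "(\<lambda>r. theta_term z Q r / (1 - Q powi (r - 1) * y)) summable_on I"
proof -
  obtain \<delta> where \<delta>: "\<delta> > 0" "\<And>r. r \<in> I \<Longrightarrow> \<delta> \<le> norm (1 - Q powi (r - 1) * y)"
    by (rule appell_denominator_bound[OF Q, of "{y}" I]) (use assms in auto)
  have "(\<lambda>r. norm (theta_term z Q r / (1 - Q powi (r - 1) * y))) summable_on I"
  proof (rule Infinite_Sum.abs_summable_on_comparison_test')
    show "(\<lambda>r. norm (theta_term z Q r) / \<delta>) summable_on I"
      using summable_on_cmult_left[OF summable_on_int_theta_term[OF Q \<open>z \<noteq> 0\<close>], of "1 / \<delta>"]
      by (auto intro: summable_on_subset_banach)
    show "norm (theta_term z Q r / (1 - Q powi (r - 1) * y)) \<le> norm (theta_term z Q r) / \<delta>" if "r \<in> I" for r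
      using \<delta>(1) \<delta>(2)[OF that] by (auto simp: norm_divide intro!: divide_left_mono mult_pos_pos)
  qed
  thus ?thesis by (rule abs_summable_summable)
qed

text \<open>The other zeros of the denominators are zeros of the theta function, so a small disc around \<open>p\<close>
  avoids them and the series converges uniformly there.\<close>

lemma appell_series_analytic_at:
  assumes Q: "norm Q < 1" "Q \<noteq> 0" and "z \<noteq> 0" "p \<noteq> 0"
    and nz: "\<And>r. r \<in> I \<Longrightarrow> Q powi (r - 1) * p \<noteq> 1"
  shows "appell_series I z Q analytic_on {p}"
proof -
  obtain e where e: "e > 0" "\<And>y. y \<noteq> p \<Longrightarrow> dist y p < e \<Longrightarrow> Theta y Q \<noteq> 0 \<and> y \<noteq> 0"
    using eventually_Theta_nonzero[OF Q \<open>p \<noteq> 0\<close>] unfolding eventually_at by auto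
  define K where "K = cball p (e / 2)"
  have K: "y \<noteq> 0 \<and> (\<forall>r\<in>I. Q powi (r - 1) * y \<noteq> 1)" if "y \<in> K" for y
  proof (cases "y = p")
    case False
    hence *: "Theta y Q \<noteq> 0" "y \<noteq> 0" using e that by (auto simp: K_def dist_commute)
    have "Q powi (r - 1) * y \<noteq> 1" for r
    proof
      assume "Q powi (r - 1) * y = 1"
      hence "y = Q powi (- (r - 1))"
        by (rule eq_powi_minusI)
      thus False using * Theta_eq_0_iff[OF Q *(2)] by auto
    qed
    thus ?thesis using * by blast
  qed (use assms in auto)
  obtain \<delta> where \<delta>: "\<delta> > 0" "\<And>r y. r \<in> I \<Longrightarrow> y \<in> K \<Longrightarrow> \<delta> \<le> norm (1 - Q powi (r - 1) * y)"
  proof (rule appell_denominator_bound[OF Q, of K I])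
    show "compact K" by (simp add: K_def)
    show "0 \<notin> K" using K by blast
    show "Q powi (r - 1) * y \<noteq> 1" if "r \<in> I" "y \<in> K" for r y using K that by blast
  qed (use that in blast)
  have "uniform_limit K (\<lambda>X y. \<Sum>r\<in>X. theta_term z Q r / (1 - Q powi (r - 1) * y))
      (appell_series I z Q) (finite_subsets_at_top I)"
    unfolding appell_series_def
  proof (rule Weierstrass_m_test_general)
    show "(\<lambda>r. norm (theta_term z Q r) / \<delta>) summable_on I"
      using summable_on_cmult_left[OF summable_on_int_theta_term[OF Q \<open>z \<noteq> 0\<close>], of "1 / \<delta>"]
      by (auto intro: summable_on_subset_banach)
    show "norm (theta_term z Q r / (1 - Q powi (r - 1) * y)) \<le> norm (theta_term z Q r) / \<delta>"
      if "r \<in> I" "y \<in> K" for r y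
      using \<delta>(1) \<delta>(2)[OF that] by (auto simp: norm_divide intro!: divide_left_mono mult_pos_pos)
  qed
  note lim = this
  have "\<forall>\<^sub>F X in finite_subsets_at_top I.
      continuous_on K (\<lambda>y. \<Sum>r\<in>X. theta_term z Q r / (1 - Q powi (r - 1) * y)) \<and>
      (\<lambda>y. \<Sum>r\<in>X. theta_term z Q r / (1 - Q powi (r - 1) * y)) holomorphic_on ball p (e / 2)"
  proof (rule eventually_finite_subsets_at_top_weakI, intro conjI)
    fix X assume X: "finite X" "X \<subseteq> I"
    have "(\<lambda>y. \<Sum>r\<in>X. theta_term z Q r / (1 - Q powi (r - 1) * y)) holomorphic_on K"
      using X K by (intro holomorphic_intros) auto
    thus "continuous_on K (\<lambda>y. \<Sum>r\<in>X. theta_term z Q r / (1 - Q powi (r - 1) * y))"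
      "(\<lambda>y. \<Sum>r\<in>X. theta_term z Q r / (1 - Q powi (r - 1) * y)) holomorphic_on ball p (e / 2)"
      unfolding K_def by (auto intro: holomorphic_on_imp_continuous_on holomorphic_on_subset)
  qed
  from holomorphic_uniform_limit[OF this[unfolded K_def] lim[unfolded K_def]]
  have "appell_series I z Q holomorphic_on ball p (e / 2)"
    by auto
  thus ?thesis
    unfolding analytic_at using e(1) by (intro exI[of _ "ball p (e / 2)"]) auto
qed

lemma appell_series_remove_term:
  assumes Q: "norm Q < 1" "Q \<noteq> 0" and "z \<noteq> 0" "y \<noteq> 0"
    and nz: "\<And>r. Q powi (r - 1) * y \<noteq> 1"
  shows "appell_series UNIV z Q y = theta_term z Q s / (1 - Q powi (s - 1) * y) + appell_series (- {s}) z Q y"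
proof -
  have "appell_series ({s} \<union> - {s}) z Q y = appell_series {s} z Q y + appell_series (- {s}) z Q y"
    unfolding appell_series_def
    by (intro infsum_Un_disjoint appell_series_summable assms) auto
  thus ?thesis by (simp add: appell_series_def)
qed

text \<open>After the index shift \<open>r \<mapsto> r + 1\<close> the terms at \<open>y\<close> have the denominators \<open>1 - Q^r y\<close> of the terms at
  \<open>Q y\<close>, and in the combination of the two these denominators cancel and leave the theta series.\<close>

lemma appell_series_shift:
  assumes Q: "norm Q < 1" "Q \<noteq> 0" and z: "z \<noteq> 0" and y: "y \<noteq> 0"
    and nz: "\<And>r. Q powi r * y \<noteq> 1"
  shows "appell_series UNIV z Q (Q * y) = Theta z Q - y / z * appell_series UNIV z Q y"
proof -
  define t where "t = (\<lambda>r. theta_term z Q r / (1 - Q powi r * y))"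
  have Qr: "Q powi (r - 1) * (Q * y) = Q powi r * y" for r
    using Q by (simp add: power_int_diff)
  have 1: "((\<lambda>r. t r) has_sum appell_series UNIV z Q (Q * y)) UNIV"
    using has_sum_infsum[OF appell_series_summable[OF Q z, of "Q * y" UNIV]] nz Q y
    by (simp add: Qr t_def appell_series_def)
  have "((\<lambda>r. theta_term z Q r / (1 - Q powi (r - 1) * y)) has_sum appell_series UNIV z Q y) UNIV"
    using has_sum_infsum[OF appell_series_summable[OF Q z y, of UNIV]] nz
    by (simp add: appell_series_def)
  also have "?this \<longleftrightarrow> ((\<lambda>r. theta_term z Q (r + 1) / (1 - Q powi r * y)) has_sum appell_series UNIV z Q y) UNIV"
    by (rule has_sum_reindex_bij_witness[of _ "\<lambda>r. r + 1" "\<lambda>r. r - 1"]) auto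
  finally have "((\<lambda>r. y / z * (theta_term z Q (r + 1) / (1 - Q powi r * y))) has_sum y / z * appell_series UNIV z Q y) UNIV"
    by (rule has_sum_cmult_right)
  moreover have "y / z * (theta_term z Q (r + 1) / (1 - Q powi r * y)) = theta_term z Q r - t r" for r
  proof -
    have "1 - Q powi r * y \<noteq> 0" using nz[of r] by simp
    thus ?thesis
      using z unfolding t_def theta_term_Suc[OF Q(2) z] by (simp add: divide_simps) (simp add: algebra_simps)
  qed
  ultimately have "((\<lambda>r. theta_term z Q r - t r) has_sum y / z * appell_series UNIV z Q y) UNIV"
    by simp
  moreover have "((\<lambda>r. theta_term z Q r - t r) has_sum Theta z Q - appell_series UNIV z Q (Q * y)) UNIV"
    unfolding diff_conv_add_uminus by (intro has_sum_add has_sum_uminusI theta_term_has_sum 1 Q z)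
  ultimately have "y / z * appell_series UNIV z Q y = Theta z Q - appell_series UNIV z Q (Q * y)"
    by (rule has_sum_unique)
  thus ?thesis by simp
qed

lemma appell_m_shift:
  assumes Q: "norm Q < 1" "Q \<noteq> 0" and "z \<noteq> 0" "x \<noteq> 0"
    and "\<And>k. z \<noteq> Q powi k" "\<And>k. x * z \<noteq> Q powi k"
  shows "appell_m (Q * x) z Q = 1 - x * appell_m x z Q"
proof -
  have "Theta z Q \<noteq> 0"
    using assms Theta_eq_0_iff by blast
  moreover have "appell_series UNIV z Q (Q * (x * z)) = Theta z Q - x * z / z * appell_series UNIV z Q (x * z)"
  proof (rule appell_series_shift[OF Q])
    fix r show "Q powi r * (x * z) \<noteq> 1"
    proof
      assume "Q powi r * (x * z) = 1"
      hence "x * z = Q powi (- r)"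
        by (rule eq_powi_minusI)
      thus False using assms by blast
    qed
  qed (use assms in auto)
  ultimately show ?thesis
    using \<open>z \<noteq> 0\<close> by (simp add: appell_m_eq_series diff_divide_distrib mult.assoc)
qed

lemma tendsto_analytic_quotient:
  assumes "f analytic_on {p}" "f p = (0 :: complex)"
  shows "((\<lambda>x. f x / (x - p)) \<longlongrightarrow> deriv f p) (at p)"
proof -
  have "f field_differentiable at p"
    using assms(1) analytic_on_imp_differentiable_at by blast
  hence "(f has_field_derivative deriv f p) (at p)"
    by (simp add: DERIV_deriv_iff_field_differentiable)
  thus ?thesis
    using assms(2) by (simp add: has_field_derivative_iff)
qed

text \<open>At a pole exactly one term of the series is singular. Its pole is simple and cancels against the
  zero of the theta function.\<close>

lemma Theta_times_appell_series_has_limit: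
  assumes Q: "norm Q < 1" "Q \<noteq> 0" and "z \<noteq> 0" "p \<noteq> 0"
  obtains l where "((\<lambda>y. Theta y Q * appell_series UNIV z Q y) \<longlongrightarrow> l) (at p)"
proof (cases "\<exists>r. Q powi (r - 1) * p = 1")
  case False
  have "(\<lambda>y. Theta y Q * appell_series UNIV z Q y) analytic_on {p}"
    using assms False by (intro analytic_intros Theta_analytic appell_series_analytic_at) auto
  thus ?thesis using that analytic_at_imp_isCont isContD by blast
next
  case True
  then obtain s where s: "Q powi (s - 1) * p = 1" by blast
  have p: "p = Q powi (1 - s)"
  proof -
    have "p = Q powi (- (s - 1))"
      using s by (rule eq_powi_minusI)
    thus ?thesis by simp
  qed
  have Theta_p: "Theta p Q = 0"
    using Theta_eq_0_iff[OF Q \<open>p \<noteq> 0\<close>] p by blast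
  have "appell_series (- {s}) z Q analytic_on {p}"
  proof (rule appell_series_analytic_at[OF Q \<open>z \<noteq> 0\<close> \<open>p \<noteq> 0\<close>])
    fix r assume r: "r \<in> - {s}"
    show "Q powi (r - 1) * p \<noteq> 1"
    proof
      assume "Q powi (r - 1) * p = 1"
      hence "Q powi (r - 1) = Q powi (s - 1)" using s \<open>p \<noteq> 0\<close> by (metis mult_right_cancel)
      thus False using r Q by (simp add: powi_eq_powi_iff)
    qed
  qed
  moreover have Theta_an: "(\<lambda>y. Theta y Q) analytic_on {p}"
    using assms by (intro Theta_analytic) auto
  ultimately have "isCont (\<lambda>y. Theta y Q * appell_series (- {s}) z Q y) p"
    by (intro analytic_at_imp_isCont analytic_intros)
  hence 1: "((\<lambda>y. Theta y Q * appell_series (- {s}) z Q y) \<longlongrightarrow> Theta p Q * appell_series (- {s}) z Q p) (at p)"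
    by (rule isContD)
  have 2: "((\<lambda>y. (- theta_term z Q s / Q powi (s - 1)) * (Theta y Q / (y - p))) \<longlongrightarrow>
      (- theta_term z Q s / Q powi (s - 1)) * deriv (\<lambda>y. Theta y Q) p) (at p)"
    by (intro tendsto_intros tendsto_analytic_quotient Theta_an Theta_p)
  have "\<forall>\<^sub>F y in at p. (- theta_term z Q s / Q powi (s - 1)) * (Theta y Q / (y - p))
      + Theta y Q * appell_series (- {s}) z Q y = Theta y Q * appell_series UNIV z Q y"
    using eventually_Theta_nonzero[OF Q \<open>p \<noteq> 0\<close>] eventually_neq_at_within[of p]
  proof eventually_elim
    case (elim y)
    have nz: "Q powi (r - 1) * y \<noteq> 1" for r
    proof
      assume "Q powi (r - 1) * y = 1"
      hence "y = Q powi (- (r - 1))"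
        by (rule eq_powi_minusI)
      thus False using elim Theta_eq_0_iff[OF Q] by blast
    qed
    have "1 - Q powi (s - 1) * y = - (Q powi (s - 1) * (y - p))"
      using s by (simp add: algebra_simps)
    hence E1: "theta_term z Q s / (1 - Q powi (s - 1) * y) = - theta_term z Q s / Q powi (s - 1) / (y - p)"
      by simp
    have E2: "appell_series UNIV z Q y = theta_term z Q s / (1 - Q powi (s - 1) * y) + appell_series (- {s}) z Q y"
      using elim by (intro appell_series_remove_term[OF Q \<open>z \<noteq> 0\<close> _ nz]) simp
    have E3: "a * (- t / w / d + b) = (- t / w) * (a / d) + a * b" for a b t w d :: complex
      by (simp add: algebra_simps)
    show ?case
      unfolding E2 E1 E3 by (rule refl)
  qed
  from Lim_transform_eventually[OF tendsto_add[OF 2 1] this] show ?thesis by (rule that)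
qed

section \<open>Multisection of the Appell function\<close>

lemma norm_power_less_1:
  fixes Q :: complex
  assumes "norm Q < 1" "m > 0"
  shows "norm (Q ^ m) < 1"
proof -
  have "norm Q ^ m \<le> norm Q ^ 1"
    by (rule power_decreasing) (use assms in auto)
  thus ?thesis using assms(1) unfolding norm_power by simp
qed

lemma power_neg_mult: "(- (c * x)) ^ n = c ^ n * (- x :: complex) ^ n"
proof -
  have "- (c * x) = c * - x" by simp
  thus ?thesis by (simp only: power_mult_distrib)
qed

lemma theta_term_mult:
  assumes "Q \<noteq> 0"
  shows "theta_term v Q (int n * k) = theta_term (- (Q powi choose2 (int n) * (- v) ^ n)) (Q ^ n\<^sup>2) k"
proof -
  define A B where "A = Q powi choose2 (int n)" and "B = (- v) ^ n"
  have "theta_term v Q (int n * k) = (- v) powi (int n * k) * Q powi choose2 (int n * k)"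
    unfolding theta_term_def by (simp flip: power_int_mult_distrib)
  also have "(- v) powi (int n * k) = B powi k"
    by (simp add: B_def power_int_mult)
  also have "Q powi choose2 (int n * k) = Q powi (int (n\<^sup>2) * choose2 k) * Q powi (choose2 (int n) * k)"
    using assms unfolding choose2_mult by (simp add: power_int_add mult.commute)
  also have "Q powi (int (n\<^sup>2) * choose2 k) = (Q ^ n\<^sup>2) powi choose2 k"
    by (rule power_int_power[symmetric])
  also have "Q powi (choose2 (int n) * k) = A powi k"
    unfolding A_def by (rule power_int_mult)
  also have "B powi k = (- 1) powi k * (- B) powi k"
    by (simp flip: power_int_mult_distrib)
  also have "(- 1) powi k * (- B) powi k * ((Q ^ n\<^sup>2) powi choose2 k * A powi k) =
      (- 1) powi k * (Q ^ n\<^sup>2) powi choose2 k * (A powi k * (- B) powi k)"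
    by (simp only: mult_ac)
  also have "A powi k * (- B) powi k = (- (A * B)) powi k"
    by (simp flip: power_int_mult_distrib)
  finally show ?thesis
    unfolding theta_term_def A_def B_def .
qed

text \<open>The theta series, sorted by the residue \<open>r\<close> of the summation index modulo \<open>n\<close>.\<close>

lemma Theta_multisection:
  assumes Q: "norm Q < 1" "Q \<noteq> 0" and t: "t \<noteq> 0" and n: "n > 0"
  shows "Theta t Q = (\<Sum>r<n. Q powi choose2 (int r) * (- t) ^ r *
           Theta (- (Q powi (choose2 (int n) + int n * int r) * (- t) ^ n)) (Q ^ n\<^sup>2))"
proof -
  define w where "w = (\<lambda>r. - (Q powi (choose2 (int n) + int n * int r) * (- t) ^ n))"
  have Qn: "norm (Q ^ n\<^sup>2) < 1" "Q ^ n\<^sup>2 \<noteq> 0"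
    using Q n by (auto intro: norm_power_less_1)
  have term_eq: "theta_term t Q (int r + int n * k) = Q powi choose2 (int r) * (- t) ^ r * theta_term (w r) (Q ^ n\<^sup>2) k" for r k
  proof -
    have "(- (Q powi int r * t)) ^ n = Q powi (int n * int r) * (- t) ^ n"
      unfolding power_neg_mult by (simp only: power_int_power' mult.commute)
    hence "Q powi choose2 (int n) * (- (Q powi int r * t)) ^ n = Q powi (choose2 (int n) + int n * int r) * (- t) ^ n"
      using Q by (simp add: power_int_add)
    moreover have "theta_term t Q (int r) = Q powi choose2 (int r) * (- t) ^ r"
      by (simp add: theta_term_def mult_ac flip: power_mult_distrib)
    ultimately show ?thesis
      using theta_term_add[OF Q(2) t, of "int r" "int n * k"] theta_term_mult[OF Q(2), of "Q powi int r * t" n k]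
      by (simp add: w_def)
  qed
  have "((\<lambda>(r, k). theta_term t Q (int r + int n * k)) has_sum Theta t Q) ({..<n} \<times> UNIV)"
  proof -
    have "(theta_term t Q has_sum Theta t Q) UNIV"
      by (rule theta_term_has_sum[OF Q t])
    also have "?this \<longleftrightarrow> ?thesis"
      using n by (intro has_sum_reindex_bij_witness[where j = "\<lambda>m. (nat (m mod int n), m div int n)" and i = "\<lambda>(r, k). int r + int n * k"])
         (auto simp: nat_less_iff)
    finally show ?thesis .
  qed
  hence "((\<lambda>r. Q powi choose2 (int r) * (- t) ^ r * Theta (w r) (Q ^ n\<^sup>2)) has_sum Theta t Q) {..<n}"
  proof (rule has_sum_SigmaD)
    fix r assume "r \<in> {..<n}"
    have "w r \<noteq> 0" using Q t by (simp add: w_def)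
    hence "((\<lambda>k. Q powi choose2 (int r) * (- t) ^ r * theta_term (w r) (Q ^ n\<^sup>2) k) has_sum
        Q powi choose2 (int r) * (- t) ^ r * Theta (w r) (Q ^ n\<^sup>2)) UNIV"
      by (intro has_sum_cmult_right theta_term_has_sum Qn)
    thus "((\<lambda>k. (\<lambda>(r, k). theta_term t Q (int r + int n * k)) (r, k)) has_sum
        Q powi choose2 (int r) * (- t) ^ r * Theta (w r) (Q ^ n\<^sup>2)) UNIV"
      by (simp add: term_eq)
  qed
  moreover have "((\<lambda>r. Q powi choose2 (int r) * (- t) ^ r * Theta (w r) (Q ^ n\<^sup>2)) has_sum
      (\<Sum>r<n. Q powi choose2 (int r) * (- t) ^ r * Theta (w r) (Q ^ n\<^sup>2))) {..<n}"
    by (rule has_sum_finite) simp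
  ultimately show ?thesis
    unfolding w_def by (rule has_sum_unique)
qed

lemma appell_series_analytic:
  assumes "norm Q < 1" "Q \<noteq> 0" "z \<noteq> 0" "f analytic_on {p}" "f p \<noteq> 0"
    and "\<And>r. r \<in> I \<Longrightarrow> Q powi (r - 1) * f p \<noteq> 1"
  shows "(\<lambda>x. appell_series I z Q (f x)) analytic_on {p}"
proof -
  have "appell_series I z Q analytic_on f ` {p}"
    using appell_series_analytic_at[OF assms(1,2,3,5,6)] by simp
  from analytic_on_compose[OF assms(4) this] show ?thesis by (simp add: o_def)
qed

context
  fixes q u w :: complex and n :: nat
begin

text \<open>The variable that locates the poles of the functions with base \<open>q^(n^2)\<close>: they lie where it is
  an integral power of \<open>q^n\<close>.\<close>

definition pole_var :: "complex \<Rightarrow> complex" where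
  "pole_var x = - (q powi choose2 (int n) * (- x) ^ n * w)"

text \<open>What becomes of the exponents congruent to \<open>r\<close> modulo \<open>n\<close> in the formal expansion
  \<open>\<Sum>k. (-1)^k q^(-k(k+1)/2) x^k\<close> of the Appell function.\<close>

definition appell_part :: "nat \<Rightarrow> complex \<Rightarrow> complex" where
  "appell_part r x = q powi (- choose2 (int r + 1)) * (- x) ^ r *
     appell_m (- (q powi (choose2 (int n) - int n * int r) * (- x) ^ n)) w (q ^ n\<^sup>2)"

text \<open>The factors in the \<open>r\<close>-th summand are chosen so that all summands scale alike under \<open>x \<mapsto> q x\<close> and
  that at a point with \<open>pole_var x = 1\<close> the sum is the multisection of \<open>Theta (x * u) q\<close>.\<close>

definition theta_numerator :: "complex \<Rightarrow> complex" where
  "theta_numerator x = (\<Sum>r<n. q powi choose2 (int r) * (- (x * u)) ^ r *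
     Theta (q ^ r * pole_var x * u) (q ^ n) * Theta (q ^ (n * r) * u ^ n / w) (q ^ n\<^sup>2) / Theta (q ^ r * u) (q ^ n))"

definition singular_points :: "complex set" where
  "singular_points = {x. Theta (x * u) q = 0 \<or> Theta (pole_var x) (q ^ n) = 0}"

definition multisection_defect :: "complex \<Rightarrow> complex" where
  "multisection_defect x = appell_m x u q - (\<Sum>r<n. appell_part r x)
     - w * qpochhammer_inf (q ^ n) (q ^ n) ^ 3 / (Theta (x * u) q * Theta w (q ^ n\<^sup>2)) * (theta_numerator x / Theta (pole_var x) (q ^ n))"

context
  assumes q: "norm q < 1" "q \<noteq> 0" and n: "n > 0"
    and u: "u \<noteq> 0" "\<And>k. u \<noteq> q powi k"
    and w: "w \<noteq> 0" "\<And>k. w \<noteq> (q ^ n\<^sup>2) powi k"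
begin

lemma qn: "norm (q ^ n) < 1" "q ^ n \<noteq> 0" "norm (q ^ n\<^sup>2) < 1" "q ^ n\<^sup>2 \<noteq> 0"
  using q n by (auto intro: norm_power_less_1)

lemma pole_var_nonzero: "x \<noteq> 0 \<Longrightarrow> pole_var x \<noteq> 0"
  using q w by (simp add: pole_var_def)

lemma pole_var_deriv:
  assumes "p \<noteq> 0"
  shows "(pole_var has_field_derivative of_nat n * pole_var p / p) (at p)"
proof -
  have "(pole_var has_field_derivative - (q powi choose2 (int n) * (of_nat n * (- p) ^ (n - 1) * (- 1)) * w)) (at p)"
    unfolding pole_var_def by (auto intro!: derivative_eq_intros)
  moreover have "(- p) ^ n = - p * (- p) ^ (n - 1)"
    using n by (metis power_eq_if neq0_conv)
  hence "of_nat n * pole_var p / p = - (q powi choose2 (int n) * (of_nat n * (- p) ^ (n - 1) * (- 1)) * w)"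
    using assms by (simp add: pole_var_def)
  ultimately show ?thesis by simp
qed

lemma pole_var_shift: "pole_var (q * x) = q ^ n * pole_var x"
  by (simp add: pole_var_def power_neg_mult mult_ac)

lemma pole_var_shift_int: "pole_var (q powi k * x) = (q ^ n) powi k * pole_var x"
proof -
  have "(- (q powi k * x)) ^ n = (q powi k) ^ n * (- x) ^ n"
    by (rule power_neg_mult)
  moreover have "(q powi k) ^ n = (q ^ n) powi k"
    by (simp add: power_int_power power_int_power' mult.commute)
  ultimately show ?thesis
    by (simp add: pole_var_def)
qed

lemma appell_part_arg: "- (q powi (choose2 (int n) - int n * int r) * (- x) ^ n) * w = q powi (- (int n * int r)) * pole_var x"
  using q by (simp add: pole_var_def power_int_diff power_int_minus field_simps)

lemma Theta_w_nonzero: "Theta w (q ^ n\<^sup>2) \<noteq> 0" and Theta_u_nonzero: "Theta u q \<noteq> 0"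
  using Theta_eq_0_iff[OF qn(3,4) w(1)] w(2) Theta_eq_0_iff[OF q u(1)] u(2) by auto

lemma Theta_qr_nonzero: "Theta (q ^ r * u) (q ^ n) \<noteq> 0"
proof
  assume "Theta (q ^ r * u) (q ^ n) = 0"
  then obtain k where "q ^ r * u = (q ^ n) powi k"
    using Theta_eq_0_iff[OF qn(1,2), of "q ^ r * u"] q u by auto
  hence "q powi int r * u = q powi (int n * k)"
    by (simp add: power_int_power)
  hence "u = q powi (int n * k - int r)"
    using q by (simp add: power_int_diff field_simps)
  thus False using u by blast
qed

text \<open>By \<open>appell_part_arg\<close> the left-hand side is the product of the two arguments of the Appell
  function in \<open>appell_part r\<close>, which must not be an integral power of the base.\<close>

lemma pole_var_regular:
  assumes "x \<noteq> 0" "Theta (pole_var x) (q ^ n) \<noteq> 0"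
  shows "q powi (- (int n * int r)) * pole_var x \<noteq> (q ^ n\<^sup>2) powi k"
proof
  assume *: "q powi (- (int n * int r)) * pole_var x = (q ^ n\<^sup>2) powi k"
  have "pole_var x = q powi (int n * int r) * (q powi (- (int n * int r)) * pole_var x)"
    using q by (simp add: power_int_minus)
  also have "\<dots> = q powi (int n * int r + int (n\<^sup>2) * k)"
    unfolding * using q by (simp add: power_int_add power_int_power)
  also have "int n * int r + int (n\<^sup>2) * k = int n * (int r + int n * k)"
    by (simp add: power2_eq_square algebra_simps)
  also have "q powi \<dots> = (q ^ n) powi (int r + int n * k)"
    by (simp add: power_int_power)
  finally show False
    using Theta_eq_0_iff[OF qn(1,2) pole_var_nonzero[OF assms(1)]] assms(2) by blast
qed

lemma nonsingularD:
  assumes "x \<noteq> 0" "x \<notin> singular_points"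
  shows "x * u \<noteq> q powi k" "q powi (- (int n * int r)) * pole_var x \<noteq> (q ^ n\<^sup>2) powi k"
  using assms u Theta_eq_0_iff[OF q, of "x * u"] pole_var_regular by (auto simp: singular_points_def)

lemma appell_part_shift_Suc: "appell_part (Suc r) (q * x) = - x * appell_part r x"
proof -
  have "choose2 (int (Suc r) + 1) = choose2 (int r + 1) + (int r + 1)"
    using choose2_add[of "int r + 1" 1] by (simp add: add.commute)
  hence "q powi (- choose2 (int (Suc r) + 1)) * q ^ Suc r = q powi (- choose2 (int r + 1))"
  proof -
    assume *: "choose2 (int (Suc r) + 1) = choose2 (int r + 1) + (int r + 1)"
    have "q powi (- choose2 (int (Suc r) + 1)) * q powi (int r + 1) = q powi (- choose2 (int (Suc r) + 1) + (int r + 1))"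
      using q by (intro power_int_add[symmetric]) auto
    moreover have "q powi (int r + 1) = q ^ Suc r"
      using power_int_of_nat[of q "Suc r"] by (simp add: add.commute)
    ultimately show ?thesis using * by simp
  qed
  hence coeff: "q powi (- choose2 (int (Suc r) + 1)) * (- (q * x)) ^ Suc r = - x * (q powi (- choose2 (int r + 1)) * (- x) ^ r)"
    unfolding power_neg_mult by (simp only: mult.assoc[symmetric]) simp
  have "q powi (choose2 (int n) - int n * int (Suc r)) * (- (q * x)) ^ n = q powi (choose2 (int n) - int n * int (Suc r)) * q powi int n * (- x) ^ n"
    by (simp add: power_neg_mult)
  also have "q powi (choose2 (int n) - int n * int (Suc r)) * q powi int n = q powi (choose2 (int n) - int n * int (Suc r) + int n)"
    using q by (intro power_int_add[symmetric]) auto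
  also have "choose2 (int n) - int n * int (Suc r) + int n = choose2 (int n) - int n * int r"
    by (simp add: algebra_simps)
  finally show ?thesis
    unfolding appell_part_def coeff by (simp only: mult.assoc)
qed

text \<open>When the residue class wraps around from \<open>n - 1\<close> to 0, the argument has moved by a full period
  \<open>q^(n^2)\<close>. This is where the functional equation of the Appell function enters and produces the
  constant 1.\<close>

lemma appell_part_shift_0:
  assumes x: "x \<noteq> 0" "x \<notin> singular_points"
  shows "appell_part 0 (q * x) = 1 - x * appell_part (n - 1) x"
proof -
  define v where "v = - (q powi (choose2 (int n) - int n * int (n - 1)) * (- x) ^ n)"
  have v0: "v \<noteq> 0" using q x by (simp add: v_def)
  have vw: "v * w \<noteq> (q ^ n\<^sup>2) powi k" for k
    using nonsingularD(2)[OF x, of "n - 1" k] unfolding v_def appell_part_arg .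
  have choose2_n: "choose2 (int n) - int n * int (n - 1) = - choose2 (int n)"
    using two_choose2[of "int n"] n by (simp add: of_nat_diff)
  have "choose2 (int n) = int (n\<^sup>2) + (- choose2 (int n)) - int n"
    using two_choose2[of "int n"] by (simp add: power2_eq_square algebra_simps)
  hence e: "choose2 (int n) + int n = int (n\<^sup>2) + (- choose2 (int n))"
    by linarith
  have "q powi (choose2 (int n)) * q powi int n = q powi (choose2 (int n) + int n)"
    using q by (intro power_int_add[symmetric]) auto
  also have "\<dots> = q powi (int (n\<^sup>2) + (- choose2 (int n)))"
    by (simp only: e)
  also have "\<dots> = q powi int (n\<^sup>2) * q powi (- choose2 (int n))"
    using q by (intro power_int_add) auto
  finally have qq: "q powi (choose2 (int n)) * q ^ n = q ^ n\<^sup>2 * q powi (- choose2 (int n))"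
    by (simp only: power_int_of_nat)
  have "(- (q * x)) ^ n = q ^ n * (- x) ^ n"
    by (rule power_neg_mult)
  hence "- (q powi choose2 (int n) * (- (q * x)) ^ n) = q ^ n\<^sup>2 * v"
    unfolding v_def choose2_n using qq by (simp flip: mult.assoc)
  hence "appell_part 0 (q * x) = appell_m (q ^ n\<^sup>2 * v) w (q ^ n\<^sup>2)"
    by (simp add: appell_part_def)
  also have "\<dots> = 1 - v * appell_m v w (q ^ n\<^sup>2)"
    by (intro appell_m_shift qn w v0 vw)
  also have "appell_part (n - 1) x = q powi (- choose2 (int n)) * (- x) ^ (n - 1) * appell_m v w (q ^ n\<^sup>2)"
    unfolding appell_part_def v_def using n by (simp add: of_nat_diff)
  hence "x * appell_part (n - 1) x = v * appell_m v w (q ^ n\<^sup>2)"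
  proof -
    assume *: "appell_part (n - 1) x = q powi (- choose2 (int n)) * (- x) ^ (n - 1) * appell_m v w (q ^ n\<^sup>2)"
    have "(- x) ^ n = - x * (- x) ^ (n - 1)"
      using n by (metis power_eq_if neq0_conv)
    hence "x * (q powi (- choose2 (int n)) * (- x) ^ (n - 1)) = v"
      unfolding v_def choose2_n by simp
    thus ?thesis unfolding * by (simp flip: mult.assoc)
  qed
  ultimately show ?thesis by simp
qed

text \<open>The shift permutes the parts cyclically, so their sum satisfies the functional equation of
  \<open>appell_m x u q\<close>.\<close>

lemma sum_appell_part_shift:
  assumes "x \<noteq> 0" "x \<notin> singular_points"
  shows "(\<Sum>r<n. appell_part r (q * x)) = 1 - x * (\<Sum>r<n. appell_part r x)"
proof -
  define m where "m = n - 1"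
  have m: "n = Suc m" using n by (simp add: m_def)
  have split: "sum f {..<n} = f m + sum f {..<m}" "sum f {..<n} = f 0 + (\<Sum>r<m. f (Suc r))" for f :: "nat \<Rightarrow> complex"
    using sum.lessThan_Suc[of f m] sum.lessThan_Suc_shift[of f m] unfolding m[symmetric]
    by (simp_all add: add.commute)
  have "(\<Sum>r<n. appell_part r (q * x)) = 1 - x * appell_part m x - x * (\<Sum>r<m. appell_part r x)"
    unfolding split(2)[of "\<lambda>r. appell_part r (q * x)"] appell_part_shift_0[OF assms] appell_part_shift_Suc m_def[symmetric]
    by (simp add: sum_distrib_left sum_negf)
  thus ?thesis
    unfolding split(1) by (simp add: algebra_simps)
qed

text \<open>In the \<open>r\<close>-th summand the power of \<open>- x u\<close> contributes \<open>q^r\<close> and the theta factor contributes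
  \<open>q^(-r)\<close>, so that the scaling does not depend on \<open>r\<close>.\<close>

lemma theta_numerator_shift:
  assumes x: "x \<noteq> 0"
  shows "theta_numerator (q * x) / Theta (pole_var (q * x)) (q ^ n) = theta_numerator x / Theta (pole_var x) (q ^ n) / u"
proof -
  have y: "pole_var x \<noteq> 0" by (rule pole_var_nonzero[OF x])
  define T where "T = (\<lambda>x r. q powi choose2 (int r) * (- (x * u)) ^ r *
     Theta (q ^ r * pole_var x * u) (q ^ n) * Theta (q ^ (n * r) * u ^ n / w) (q ^ n\<^sup>2) / Theta (q ^ r * u) (q ^ n))"
  have "T (q * x) r = - (T x r / (pole_var x * u))" for r
  proof -
    have "Theta (q ^ r * pole_var (q * x) * u) (q ^ n) = Theta (q ^ n * (q ^ r * pole_var x * u)) (q ^ n)"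
      by (simp add: pole_var_shift mult_ac)
    also have "\<dots> = - Theta (q ^ r * pole_var x * u) (q ^ n) / (q ^ r * pole_var x * u)"
      using y u q by (intro Theta_shift qn) auto
    finally have 1: "Theta (q ^ r * pole_var (q * x) * u) (q ^ n) = - Theta (q ^ r * pole_var x * u) (q ^ n) / (q ^ r * pole_var x * u)" .
    have 2: "(- (q * x * u)) ^ r = q ^ r * (- (x * u)) ^ r"
      unfolding mult.assoc by (rule power_neg_mult)
    show ?thesis
      unfolding T_def 1 2 using q y u by (simp add: field_simps)
  qed
  hence "(\<Sum>r<n. T (q * x) r) = - ((\<Sum>r<n. T x r) / (pole_var x * u))"
    by (simp add: sum_negf sum_divide_distrib)
  hence "theta_numerator (q * x) = - (theta_numerator x / (pole_var x * u))"
    unfolding theta_numerator_def T_def .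
  moreover have "Theta (pole_var (q * x)) (q ^ n) = - Theta (pole_var x) (q ^ n) / pole_var x"
    unfolding pole_var_shift by (intro Theta_shift qn y)
  ultimately show ?thesis using y by simp
qed

text \<open>The constants 1 in the functional equations of the Appell function and of the sum of its parts
  cancel, which leaves the factor \<open>- x\<close>; the factor \<open>Theta (x * u) q\<close> contributes \<open>- 1 / (x u)\<close>.\<close>

lemma multisection_defect_shift:
  assumes x: "x \<noteq> 0" "x \<notin> singular_points"
  shows "Theta (q * x * u) q * multisection_defect (q * x) = inverse u * (Theta (x * u) q * multisection_defect x)"
proof -
  have T: "Theta (q * x * u) q = - Theta (x * u) q / (x * u)"
    unfolding mult.assoc by (intro Theta_shift q) (use x u in auto)
  have T0: "Theta (x * u) q \<noteq> 0" using x by (simp add: singular_points_def)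
  define C where "C = w * qpochhammer_inf (q ^ n) (q ^ n) ^ 3 / Theta w (q ^ n\<^sup>2)"
  have d: "multisection_defect x = appell_m x u q - (\<Sum>r<n. appell_part r x) - C / Theta (x * u) q * (theta_numerator x / Theta (pole_var x) (q ^ n))" for x
    unfolding multisection_defect_def C_def by (simp add: mult.commute)
  have "multisection_defect (q * x) = (1 - x * appell_m x u q) - (1 - x * (\<Sum>r<n. appell_part r x))
      - C / (- Theta (x * u) q / (x * u)) * (theta_numerator x / Theta (pole_var x) (q ^ n) / u)"
    unfolding d T theta_numerator_shift[OF x(1)] sum_appell_part_shift[OF x]
    using appell_m_shift[OF q u(1) x(1) u(2) nonsingularD(1)[OF x]] by simp
  also have "C / (- Theta (x * u) q / (x * u)) * (theta_numerator x / Theta (pole_var x) (q ^ n) / u)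
      = - x * (C / Theta (x * u) q * (theta_numerator x / Theta (pole_var x) (q ^ n)))"
    using T0 x u by simp
  finally have "multisection_defect (q * x) = - x * multisection_defect x"
    unfolding d by (simp add: algebra_simps)
  thus ?thesis
    unfolding T using x u by (simp add: field_simps)
qed

lemma pole_var_analytic: "pole_var analytic_on A"
  unfolding pole_var_def by (intro analytic_intros)

lemma theta_numerator_analytic:
  assumes p: "p \<noteq> 0"
  shows "theta_numerator analytic_on {p}"
proof -
  have "(\<lambda>x. Theta (q ^ r * pole_var x * u) (q ^ n)) analytic_on {p}" for r
    by (intro Theta_analytic analytic_intros pole_var_analytic qn) (use pole_var_nonzero[OF p] q u in auto)
  thus ?thesis
    unfolding theta_numerator_def by (intro analytic_intros) (use Theta_qr_nonzero in auto)
qed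

lemma Theta_xu_analytic: "p \<noteq> 0 \<Longrightarrow> (\<lambda>x. Theta (x * u) q) analytic_on {p}"
  using u by (intro Theta_analytic q analytic_intros) auto

lemma Theta_pole_var_analytic: "p \<noteq> 0 \<Longrightarrow> (\<lambda>x. Theta (pole_var x) (q ^ n)) analytic_on {p}"
  using pole_var_nonzero by (intro Theta_analytic qn pole_var_analytic) auto

lemma appell_part_eq: "appell_part r x = q powi (- choose2 (int r + 1)) * (- x) ^ r *
    (appell_series UNIV w (q ^ n\<^sup>2) (q powi (- (int n * int r)) * pole_var x) / Theta w (q ^ n\<^sup>2))"
  unfolding appell_part_def appell_m_eq_series appell_part_arg ..

lemma appell_part_analytic:
  assumes p: "p \<noteq> 0" and nz: "\<And>k. q powi (- (int n * int r)) * pole_var p \<noteq> (q ^ n\<^sup>2) powi k"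
  shows "appell_part r analytic_on {p}"
proof -
  have "(\<lambda>x. appell_series UNIV w (q ^ n\<^sup>2) (q powi (- (int n * int r)) * pole_var x)) analytic_on {p}"
  proof (rule appell_series_analytic[OF qn(3,4) w(1)])
    show "(\<lambda>x. q powi (- (int n * int r)) * pole_var x) analytic_on {p}"
      by (intro analytic_intros pole_var_analytic)
    show "q powi (- (int n * int r)) * pole_var p \<noteq> 0" using pole_var_nonzero[OF p] q by simp
    show "(q ^ n\<^sup>2) powi (k - 1) * (q powi (- (int n * int r)) * pole_var p) \<noteq> 1" for k
    proof
      assume "(q ^ n\<^sup>2) powi (k - 1) * (q powi (- (int n * int r)) * pole_var p) = 1"
      hence "q powi (- (int n * int r)) * pole_var p = (q ^ n\<^sup>2) powi (- (k - 1))"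
        by (rule eq_powi_minusI)
      thus False using nz by blast
    qed
  qed
  thus ?thesis
    unfolding appell_part_eq using Theta_w_nonzero by (intro analytic_intros) auto
qed

lemma appell_m_analytic:
  assumes p: "p \<noteq> 0" "Theta (p * u) q \<noteq> 0"
  shows "(\<lambda>x. appell_m x u q) analytic_on {p}"
proof -
  have "(\<lambda>x. appell_series UNIV u q (x * u)) analytic_on {p}"
  proof (rule appell_series_analytic[OF q u(1)])
    show "q powi (k - 1) * (p * u) \<noteq> 1" for k
    proof
      assume "q powi (k - 1) * (p * u) = 1"
      hence "p * u = q powi (- (k - 1))"
        by (rule eq_powi_minusI)
      hence "Theta (p * u) q = 0"
        using Theta_eq_0_iff[OF q, of "p * u"] p(1) u(1) by (metis mult_eq_0_iff)
      thus False using p(2) by blast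
    qed
  qed (use p u in \<open>auto intro!: analytic_intros\<close>)
  thus ?thesis
    unfolding appell_m_eq_series using Theta_u_nonzero by (intro analytic_intros) auto
qed

lemma Theta_times_appell_m_limit:
  assumes p: "p \<noteq> 0"
  obtains l where "((\<lambda>x. Theta (x * u) q * appell_m x u q) \<longlongrightarrow> l) (at p)"
proof -
  obtain l where l: "((\<lambda>y. Theta y q * appell_series UNIV u q y) \<longlongrightarrow> l) (at (p * u))"
    using Theta_times_appell_series_has_limit[OF q u(1), of "p * u"] p u by auto
  have "filterlim (\<lambda>x. x * u) (at (p * u)) (at p)"
    using u by (intro filterlim_atI tendsto_intros) (auto simp: eventually_at_filter)
  from filterlim_compose[OF l this]
  have "((\<lambda>x. Theta (x * u) q * appell_series UNIV u q (x * u) / Theta u q) \<longlongrightarrow> l / Theta u q) (at p)"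
    using Theta_u_nonzero by (intro tendsto_intros) auto
  thus ?thesis using that by (simp add: appell_m_eq_series)
qed

text \<open>Both \<open>x u\<close> and \<open>pole_var x\<close> are locally injective in \<open>x\<close>, so the isolation of the zeros of the theta
  functions carries over.\<close>

lemma eventually_nonsingular:
  assumes p: "p \<noteq> 0"
  shows "\<forall>\<^sub>F x in at p. x \<notin> singular_points"
proof -
  have nc: "\<forall>\<^sub>F x in at p. f x \<noteq> f p" if "(f has_field_derivative d) (at p)" "d \<noteq> 0" for f :: "complex \<Rightarrow> complex" and d
  proof -
    have "((\<lambda>x. (f x - f p) / (x - p)) \<longlongrightarrow> d) (at p)"
      using that(1) by (simp add: has_field_derivative_iff)
    hence "\<forall>\<^sub>F x in at p. (f x - f p) / (x - p) \<noteq> 0"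
      using that(2) tendsto_imp_eventually_ne by blast
    thus ?thesis by eventually_elim auto
  qed
  have lim: "filterlim f (at (f p)) (at p)" if "(f has_field_derivative d) (at p)" "d \<noteq> 0" for f :: "complex \<Rightarrow> complex" and d
    using nc[OF that] DERIV_isCont[OF that(1)] by (intro filterlim_atI) (auto simp: isCont_def)
  have "((\<lambda>x. x * u) has_field_derivative u) (at p)"
    by (auto intro!: derivative_eq_intros)
  from eventually_compose_filterlim[OF eventually_Theta_nonzero[OF q] lim[OF this u(1)]]
  have 1: "\<forall>\<^sub>F x in at p. Theta (x * u) q \<noteq> 0 \<and> x * u \<noteq> 0"
    using p u by simp
  from eventually_compose_filterlim[OF eventually_Theta_nonzero[OF qn(1,2)] lim[OF pole_var_deriv[OF p]]]
  have 2: "\<forall>\<^sub>F x in at p. Theta (pole_var x) (q ^ n) \<noteq> 0 \<and> pole_var x \<noteq> 0"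
    using pole_var_nonzero[OF p] p n by simp
  show ?thesis
    using 1 2 by eventually_elim (simp add: singular_points_def)
qed

lemma multisection_defect_analytic:
  assumes p: "p \<noteq> 0" "p \<notin> singular_points"
  shows "(\<lambda>x. Theta (x * u) q * multisection_defect x) analytic_on {p}"
proof -
  have nz: "Theta (p * u) q \<noteq> 0" "Theta (pole_var p) (q ^ n) \<noteq> 0" using p by (auto simp: singular_points_def)
  have "multisection_defect analytic_on {p}"
    unfolding multisection_defect_def
    by (intro analytic_intros appell_m_analytic appell_part_analytic nonsingularD Theta_xu_analytic
        Theta_pole_var_analytic theta_numerator_analytic p nz) (use nz Theta_w_nonzero in auto)
  thus ?thesis by (intro analytic_intros Theta_xu_analytic p)
qed

text \<open>The residue computation: at such a point the theta factors that depend on \<open>x\<close> cancel against the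
  denominators, and the sum that remains is the multisection of the theta series at \<open>p u\<close>.\<close>

lemma theta_numerator_at_pole:
  assumes p: "p \<noteq> 0" "pole_var p = 1"
  shows "theta_numerator p = Theta (p * u) q"
proof -
  have mp: "q powi choose2 (int n) * (- p) ^ n = - (1 / w)"
    using p(2) w by (simp add: pole_var_def field_simps) (metis minus_equation_iff mult.assoc mult.commute)
  have "- (q powi (choose2 (int n) + int n * int r) * (- (p * u)) ^ n) = q ^ (n * r) * u ^ n / w" for r
  proof -
    have "q powi (choose2 (int n) + int n * int r) = q powi choose2 (int n) * q powi (int (n * r))"
      using q by (subst power_int_add) auto
    moreover have "(- (p * u)) ^ n = (- p) ^ n * u ^ n"
      using power_neg_mult[of u p n] by (simp add: mult.commute)
    ultimately have "q powi (choose2 (int n) + int n * int r) * (- (p * u)) ^ n = (q powi choose2 (int n) * (- p) ^ n) * (q ^ (n * r) * u ^ n)"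
      by (simp only: power_int_of_nat mult_ac)
    thus ?thesis unfolding mp by simp
  qed
  moreover have "Theta (p * u) q = (\<Sum>r<n. q powi choose2 (int r) * (- (p * u)) ^ r *
           Theta (- (q powi (choose2 (int n) + int n * int r) * (- (p * u)) ^ n)) (q ^ n\<^sup>2))"
    by (rule Theta_multisection[OF q _ n]) (use p u in auto)
  ultimately show ?thesis
    unfolding theta_numerator_def p(2) using Theta_qr_nonzero by (simp add: mult.assoc)
qed

text \<open>Here the theta quotient and the functions with base \<open>q^(n^2)\<close> are regular after multiplication by
  \<open>Theta (x * u) q\<close>, and only \<open>appell_m x u q\<close> needs the cancellation of a pole.\<close>

lemma multisection_defect_limit_regular:
  assumes p: "p \<noteq> 0" "Theta (pole_var p) (q ^ n) \<noteq> 0"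
  shows "\<exists>l. ((\<lambda>x. Theta (x * u) q * multisection_defect x) \<longlongrightarrow> l) (at p)"
proof -
  define C where "C = w * qpochhammer_inf (q ^ n) (q ^ n) ^ 3 / Theta w (q ^ n\<^sup>2)"
  obtain l where l: "((\<lambda>x. Theta (x * u) q * appell_m x u q) \<longlongrightarrow> l) (at p)"
    using Theta_times_appell_m_limit[OF p(1)] .
  define g where "g = (\<lambda>x. Theta (x * u) q * (\<Sum>r<n. appell_part r x) + C * (theta_numerator x / Theta (pole_var x) (q ^ n)))"
  have "g analytic_on {p}"
    unfolding g_def
    by (intro analytic_intros appell_part_analytic pole_var_regular Theta_xu_analytic Theta_pole_var_analytic theta_numerator_analytic p) (use p in auto)
  hence "(g \<longlongrightarrow> g p) (at p)"
    by (intro isContD analytic_at_imp_isCont)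
  from tendsto_diff[OF l this]
  have lim: "((\<lambda>x. Theta (x * u) q * appell_m x u q - g x) \<longlongrightarrow> l - g p) (at p)" .
  have "\<forall>\<^sub>F x in at p. Theta (x * u) q * appell_m x u q - g x = Theta (x * u) q * multisection_defect x"
    using eventually_nonsingular[OF p(1)]
  proof eventually_elim
    case (elim x)
    hence T: "Theta (x * u) q \<noteq> 0" by (simp add: singular_points_def)
    have alg: "t * (m - s - c / (t * w') * y) = t * m - (t * s + c / w' * y)" if "t \<noteq> 0" for t m s c w' y :: complex
    proof -
      have "t * (c / (t * w') * y) = c / w' * y" using that by simp
      moreover have "t * (m - s - z) = t * m - (t * s + t * z)" for z
        by (simp add: right_diff_distrib)
      ultimately show ?thesis by (simp only:)
    qed
    show ?case
      unfolding multisection_defect_def g_def C_def using alg[OF T, symmetric] .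
  qed
  from Lim_transform_eventually[OF lim this] show ?thesis by (rule exI)
qed

text \<open>With \<open>y = pole_var x\<close>, the singular contributions are the term of index 1 in the series of
  \<open>appell_part 0\<close> and the theta quotient. Each has a simple pole in \<open>y\<close> at 1. Over the common
  denominator \<open>1 - y\<close> their numerator is a multiple of \<open>N\<close>, and \<open>N p = 0\<close> by the preceding
  residue computation.\<close>

lemma multisection_defect_limit_pole:
  assumes p: "p \<noteq> 0" "pole_var p = 1"
  shows "\<exists>l. ((\<lambda>x. Theta (x * u) q * multisection_defect x) \<longlongrightarrow> l) (at p)"
proof -
  define J where "J = qpochhammer_inf (q ^ n) (q ^ n) ^ 3"
  define W where "W = Theta w (q ^ n\<^sup>2)"
  define N where "N = (\<lambda>x. Theta (x * u) q - J * theta_numerator x / regular_Theta (pole_var x) (q ^ n))"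
  define A where "A = (\<lambda>x. appell_series (- {1}) w (q ^ n\<^sup>2) (pole_var x))"
  define g where "g = (\<lambda>x. Theta (x * u) q * (\<Sum>r\<in>{1..<n}. appell_part r x) + Theta (x * u) q * A x / W)"
  have W: "W \<noteq> 0" unfolding W_def by (rule Theta_w_nonzero)
  have J: "J \<noteq> 0" unfolding J_def using qpochhammer_inf_self_nonzero[OF qn(1)] by simp
  have reg: "regular_Theta (pole_var p) (q ^ n) = J" unfolding p(2) regular_Theta_1 J_def ..
  obtain l where l: "((\<lambda>x. Theta (x * u) q * appell_m x u q) \<longlongrightarrow> l) (at p)"
    using Theta_times_appell_m_limit[OF p(1)] .
  \<comment> \<open>The parts with \<open>0 < r < n\<close> are regular at \<open>p\<close>, since \<open>n\<close> does not divide \<open>r\<close>.\<close>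
  have mp: "q powi (- (int n * int r)) * pole_var p \<noteq> (q ^ n\<^sup>2) powi k" if r: "r \<in> {1..<n}" for r k
  proof
    assume "q powi (- (int n * int r)) * pole_var p = (q ^ n\<^sup>2) powi k"
    hence "q powi (- (int n * int r)) = q powi (int (n\<^sup>2) * k)"
      using p by (simp add: power_int_power)
    hence "- (int n * int r) = int (n\<^sup>2) * k"
      by (simp only: powi_eq_powi_iff[OF q])
    hence "int n * int r = int n * (int n * (- k))"
      by (simp add: power2_eq_square)
    hence "int r = int n * (- k)" using n by (subst (asm) mult_cancel_left) auto
    hence "int n dvd int r" by (rule dvdI)
    hence "n dvd r" by simp
    thus False using r by (auto dest: dvd_imp_le)
  qed
  \<comment> \<open>Without its term of index 1 the series of \<open>appell_part 0\<close> is regular at \<open>p\<close>.\<close>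
  have A_an: "A analytic_on {p}"
    unfolding A_def
  proof (rule appell_series_analytic[OF qn(3,4) w(1) pole_var_analytic])
    show "pole_var p \<noteq> 0" by (rule pole_var_nonzero[OF p(1)])
    show "(q ^ n\<^sup>2) powi (r - 1) * pole_var p \<noteq> 1" if "r \<in> - {1}" for r
    proof
      assume "(q ^ n\<^sup>2) powi (r - 1) * pole_var p = 1"
      hence "(q ^ n\<^sup>2) powi (r - 1) = (q ^ n\<^sup>2) powi 0" using p by simp
      hence "r - 1 = 0" by (simp only: powi_eq_powi_iff[OF qn(3,4)])
      thus False using that by simp
    qed
  qed
  have "g analytic_on {p}"
    unfolding g_def
    by (intro analytic_intros appell_part_analytic mp Theta_xu_analytic A_an p) (use W in auto)
  hence g_lim: "(g \<longlongrightarrow> g p) (at p)"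
    by (intro isContD analytic_at_imp_isCont)
  have N_an: "N analytic_on {p}"
    unfolding N_def
    by (intro analytic_intros Theta_xu_analytic theta_numerator_analytic regular_Theta_analytic pole_var_analytic qn p)
       (use pole_var_nonzero[OF p(1)] reg J in auto)
  have "N p = 0"
    unfolding N_def reg theta_numerator_at_pole[OF p] using J by simp
  from tendsto_analytic_quotient[OF N_an this]
  have N_lim: "((\<lambda>x. N x / (x - p)) \<longlongrightarrow> deriv N p) (at p)" .
  have D_lim: "((\<lambda>x. (pole_var x - 1) / (x - p)) \<longlongrightarrow> of_nat n * pole_var p / p) (at p)"
    using pole_var_deriv[OF p(1)] p(2) by (simp add: has_field_derivative_iff)
  \<comment> \<open>The zero of \<open>1 - pole_var x\<close> at \<open>p\<close> is simple.\<close>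
  have D0: "of_nat n * pole_var p / p \<noteq> 0"
    using n p by simp
  have lim: "((\<lambda>x. Theta (x * u) q * appell_m x u q - g x + - (w / W) * ((N x / (x - p)) / ((pole_var x - 1) / (x - p))))
      \<longlongrightarrow> l - g p + - (w / W) * (deriv N p / (of_nat n * pole_var p / p))) (at p)"
    by (intro tendsto_add tendsto_diff tendsto_mult_left tendsto_divide l g_lim N_lim D_lim D0)
  have reg_ev: "\<forall>\<^sub>F x in at p. x \<noteq> 0 \<and> x \<noteq> p"
    using p by (intro eventually_conj eventually_neq_at_within)
  have "\<forall>\<^sub>F x in at p. Theta (x * u) q * appell_m x u q - g x + - (w / W) * ((N x / (x - p)) / ((pole_var x - 1) / (x - p)))
      = Theta (x * u) q * multisection_defect x"
    using eventually_nonsingular[OF p(1)] reg_ev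
  proof eventually_elim
    case (elim x)
    define T B R S m where "T = Theta (x * u) q" and "B = A x" and "R = regular_Theta (pole_var x) (q ^ n)"
      and "S = theta_numerator x" and "m = (\<Sum>r\<in>{1..<n}. appell_part r x)"
    define y where "y = pole_var x"
    have T: "T \<noteq> 0" using elim by (simp add: singular_points_def T_def)
    have yR: "Theta (pole_var x) (q ^ n) = (1 - y) * R"
      unfolding R_def y_def by (rule Theta_eq_regular[OF qn(1)])
    hence nz: "1 - y \<noteq> 0" "R \<noteq> 0" using elim by (auto simp: singular_points_def)
    have "appell_series UNIV w (q ^ n\<^sup>2) y = theta_term w (q ^ n\<^sup>2) 1 / (1 - (q ^ n\<^sup>2) powi (1 - 1) * y) + B"
      unfolding B_def A_def y_def
    proof (rule appell_series_remove_term[OF qn(3,4) w(1)])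
      show "pole_var x \<noteq> 0" using pole_var_nonzero elim by blast
      show "(q ^ n\<^sup>2) powi (r - 1) * pole_var x \<noteq> 1" for r
      proof
        assume "(q ^ n\<^sup>2) powi (r - 1) * pole_var x = 1"
        hence "pole_var x = (q ^ n\<^sup>2) powi (- (r - 1))"
          by (rule eq_powi_minusI)
        thus False using nonsingularD(2)[of x 0] elim by auto
      qed
    qed
    hence "appell_part 0 x = (- w / (1 - y) + B) / W"
      unfolding appell_part_eq W_def by (simp add: theta_term_def y_def)
    moreover have "(\<Sum>r<n. appell_part r x) = appell_part 0 x + m"
      unfolding m_def lessThan_atLeast0 using n by (subst sum.atLeast_Suc_lessThan) auto
    ultimately have sum_eq: "(\<Sum>r<n. appell_part r x) = (- w / (1 - y) + B) / W + m" by simp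
    have N_eq: "N x / (x - p) / ((pole_var x - 1) / (x - p)) = - ((T - J * S / R) / (1 - y))"
    proof -
      have "N x / (x - p) / ((pole_var x - 1) / (x - p)) = N x / (y - 1)"
        using elim by (simp add: y_def)
      also have "y - 1 = - (1 - y)" by simp
      also have "N x / - (1 - y) = - (N x / (1 - y))" by (rule divide_minus_right)
      also have "- (N x / (1 - y)) = - ((T - J * S / R) / (1 - y))"
        by (simp only: N_def T_def S_def R_def)
      finally show ?thesis .
    qed
    have alg: "T * M - (T * m + T * B / W) + - (w / W) * - ((T - J * S / R) / d)
       = T * (M - ((- w / d + B) / W + m) - w * J / (T * W) * (S / (d * R)))" if "d \<noteq> 0" for M d
      using T nz(2) W that by (simp add: field_simps)
    show ?case
      unfolding multisection_defect_def sum_eq yR N_eq g_def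
      unfolding J_def[symmetric] W_def[symmetric] T_def[symmetric] B_def[symmetric] S_def[symmetric] m_def[symmetric]
      by (rule alg[OF nz(1)])
  qed
  from Lim_transform_eventually[OF lim this] show ?thesis by (rule exI)
qed

text \<open>If \<open>pole_var p\<close> is a power \<open>(q^n)^k\<close>, then \<open>q^(-k) p\<close> is a point of the same orbit where \<open>pole_var\<close> is
  1. Hence the limits above cover all orbits of singular points, and the difference of the two
  sides, multiplied by \<open>Theta (x * u) q\<close>, is a quasi-periodic function whose multiplier \<open>1 / u\<close> is not
  a power of \<open>q\<close>.\<close>

theorem appell_m_multisection:
  assumes x: "x \<noteq> 0" "x \<notin> singular_points"
  shows "appell_m x u q = (\<Sum>r<n. appell_part r x)
    + w * qpochhammer_inf (q ^ n) (q ^ n) ^ 3 / (Theta (x * u) q * Theta w (q ^ n\<^sup>2))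
      * (theta_numerator x / Theta (pole_var x) (q ^ n))"
proof -
  have "Theta (x * u) q * multisection_defect x = 0"
  proof (rule quasi_periodic_removable_eq_0[where q = q and \<mu> = "inverse u" and P = singular_points
        and h = "\<lambda>x. Theta (x * u) q * multisection_defect x"])
    show "inverse u \<noteq> q powi k" for k
    proof
      assume "inverse u = q powi k"
      hence "u = q powi (- k)" by (metis inverse_inverse_eq power_int_minus)
      thus False using u by blast
    qed
    show "(\<lambda>x. Theta (x * u) q * multisection_defect x) analytic_on - {0} - singular_points"
      by (subst analytic_on_analytic_at) (use multisection_defect_analytic in auto)
    fix p assume p: "p \<noteq> 0" "p \<in> singular_points"
    show "\<exists>(k :: int) l. ((\<lambda>x. Theta (x * u) q * multisection_defect x) \<longlongrightarrow> l) (at (q powi k * p))"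
    proof (cases "Theta (pole_var p) (q ^ n) = 0")
      case False
      from multisection_defect_limit_regular[OF p(1) this] show ?thesis by (intro exI[of _ "0 :: int"]) simp
    next
      case True
      then obtain k where k: "pole_var p = (q ^ n) powi k"
        using Theta_eq_0_iff[OF qn(1,2) pole_var_nonzero[OF p(1)]] by blast
      have "pole_var (q powi (- k) * p) = 1"
        unfolding pole_var_shift_int k using q by (simp add: power_int_minus)
      moreover have "q powi (- k) * p \<noteq> 0" using p q by simp
      ultimately show ?thesis using multisection_defect_limit_pole by blast
    qed
  qed (use q u x eventually_nonsingular multisection_defect_shift in \<open>auto simp: mult.assoc\<close>)
  hence "multisection_defect x = 0" using x by (simp add: singular_points_def)
  thus ?thesis unfolding multisection_defect_def diff_diff_eq by (rule iffD1[OF right_minus_eq])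
qed

end

end

section \<open>Theta identities and special cases\<close>

text \<open>The factors with even and with odd powers of \<open>Q\<close>.\<close>

lemma qpochhammer_inf_split:
  assumes "norm Q < 1"
  shows "qpochhammer_inf x Q = qpochhammer_inf x (Q\<^sup>2) * qpochhammer_inf (Q * x) (Q\<^sup>2)"
proof -
  have Q2: "norm (Q\<^sup>2) < 1" using norm_power_less_1[OF assms, of 2] by simp
  have "(\<Prod>i<2 * N. 1 - Q ^ i * x) = (\<Prod>i<N. 1 - (Q\<^sup>2) ^ i * x) * (\<Prod>i<N. 1 - (Q\<^sup>2) ^ i * (Q * x))" for N
    by (induction N) (simp_all add: mult_ac flip: power_mult)
  moreover have "(\<lambda>N. (\<Prod>i<N. 1 - (Q\<^sup>2) ^ i * x) * (\<Prod>i<N. 1 - (Q\<^sup>2) ^ i * (Q * x)))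
      \<longlonglongrightarrow> qpochhammer_inf x (Q\<^sup>2) * qpochhammer_inf (Q * x) (Q\<^sup>2)"
    by (intro tendsto_mult qpochhammer_inf_tendsto Q2)
  moreover have "filterlim (\<lambda>N. 2 * N) at_top (sequentially :: nat filter)"
    by (rule filterlim_subseq) (simp add: strict_mono_def)
  from filterlim_compose[OF qpochhammer_inf_tendsto[OF assms] this]
  have "(\<lambda>N. \<Prod>i<2 * N. 1 - Q ^ i * x) \<longlonglongrightarrow> qpochhammer_inf x Q" .
  ultimately show ?thesis
    using LIMSEQ_unique by simp
qed

lemma Theta_reflect: "Q \<noteq> 0 \<Longrightarrow> Theta (Q / x) Q = Theta x Q"
  by (simp add: Theta_def)

lemma Theta_inverse:
  assumes "norm Q < 1" "Q \<noteq> 0" "x \<noteq> 0"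
  shows "Theta (1 / x) Q = - Theta x Q / x"
  using Theta_shift[OF assms(1,2), of "1 / x"] Theta_reflect[OF assms(2), of x] assms by (simp add: field_simps)

lemma Theta_base_split:
  assumes "norm Q < 1" "Q \<noteq> 0" "x \<noteq> 0"
  shows "Theta x (Q\<^sup>2) * Theta (Q * x) (Q\<^sup>2) * qpochhammer_inf Q Q = Theta x Q * qpochhammer_inf (Q\<^sup>2) (Q\<^sup>2) ^ 2"
proof -
  have "Q\<^sup>2 / x = Q * (Q / x)" "Q\<^sup>2 / (Q * x) = Q / x"
    using assms by (simp_all add: power2_eq_square)
  thus ?thesis
    using qpochhammer_inf_split[OF assms(1), of x] qpochhammer_inf_split[OF assms(1), of "Q / x"]
    by (simp add: Theta_def power2_eq_square mult_ac)
qed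

lemma Theta_self_base_4:
  assumes "norm Q < 1" "Q \<noteq> 0"
  shows "Theta Q (Q ^ 4) * qpochhammer_inf (Q\<^sup>2) (Q\<^sup>2) = qpochhammer_inf Q Q * qpochhammer_inf (Q ^ 4) (Q ^ 4)"
proof -
  have Q2: "norm (Q\<^sup>2) < 1" using norm_power_less_1[OF assms(1), of 2] by simp
  have eqs: "(Q\<^sup>2)\<^sup>2 = Q ^ 4" "Q * Q = Q\<^sup>2" "Q\<^sup>2 * Q = Q ^ 3" "Q ^ 4 / Q = Q ^ 3"
    using assms by (simp_all add: power2_eq_square eval_nat_numeral)
  have "qpochhammer_inf Q Q = qpochhammer_inf Q (Q\<^sup>2) * qpochhammer_inf (Q\<^sup>2) (Q\<^sup>2)"
    using qpochhammer_inf_split[OF assms(1), of Q] unfolding eqs .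
  moreover have "qpochhammer_inf Q (Q\<^sup>2) = qpochhammer_inf Q (Q ^ 4) * qpochhammer_inf (Q ^ 3) (Q ^ 4)"
    using qpochhammer_inf_split[OF Q2, of Q] unfolding eqs .
  ultimately show ?thesis
    by (simp add: Theta_def eqs mult_ac)
qed

lemma Theta_even_odd:
  assumes "norm Q < 1" "Q \<noteq> 0" "t \<noteq> 0"
  shows "Theta t Q = Theta (- (Q * t\<^sup>2)) (Q ^ 4) - t * Theta (- (Q ^ 3 * t\<^sup>2)) (Q ^ 4)"
proof -
  have "choose2 2 = 1" by (simp add: choose2_def)
  moreover have "(\<Sum>r<2. f r) = f 0 + f (1 :: nat)" for f :: "nat \<Rightarrow> complex"
    by (simp add: numeral_2_eq_2)
  ultimately show ?thesis
    using Theta_multisection[OF assms, of 2] by simp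
qed

text \<open>Multisection with \<open>n = 1\<close> and \<open>w = 1 / (x z)\<close>: the single summand of the theta numerator contains
  \<open>Theta 1 q\<close>.\<close>

lemma appell_m_swap:
  assumes q: "norm q < 1" "q \<noteq> 0" and nz: "x \<noteq> 0" "z \<noteq> 0"
    and gen: "\<And>k. z \<noteq> q powi k" "\<And>k. x * z \<noteq> q powi k"
  shows "appell_m x z q = appell_m x (1 / (x * z)) q"
proof -
  define w where "w = 1 / (x * z)"
  have inv: "a = q powi (- k)" if "1 / a = q powi k" for a k
    using that by (metis inverse_eq_divide inverse_inverse_eq power_int_minus)
  have w: "w \<noteq> 0" "w \<noteq> (q ^ 1\<^sup>2) powi k" for k
    using nz gen(2) inv[of "x * z" k] by (auto simp: w_def)
  have xw: "x * w = 1 / z" using nz by (simp add: w_def)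
  have mv: "pole_var q w (Suc 0) x = x * w"
    by (simp add: pole_var_def)
  have "1 / z \<noteq> q powi k" for k
    using gen(1) inv[of z k] by blast
  hence "Theta (1 / z) q \<noteq> 0"
    using Theta_eq_0_iff[OF q, of "1 / z"] nz by simp
  moreover have "Theta (x * z) q \<noteq> 0"
    using Theta_eq_0_iff[OF q, of "x * z"] nz gen(2) by simp
  ultimately have "x \<notin> singular_points q z w 1"
    by (simp add: singular_points_def mv xw)
  from appell_m_multisection[OF q _ nz(2) gen(1) w nz(1) this]
  have "appell_m x z q = (\<Sum>r<1. appell_part q w 1 r x)
    + w * qpochhammer_inf (q ^ 1) (q ^ 1) ^ 3 / (Theta (x * z) q * Theta w (q ^ 1\<^sup>2))
      * (theta_numerator q z w 1 x / Theta (pole_var q w 1 x) (q ^ 1))"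
    by simp
  moreover have "theta_numerator q z w 1 x = 0"
    using nz q by (simp add: theta_numerator_def mv xw)
  moreover have "appell_part q w 1 0 x = appell_m x w q"
    by (simp add: appell_part_def)
  ultimately show ?thesis
    by (simp add: w_def)
qed

text \<open>Multisection with \<open>n = 4\<close>; the four parts are the subtracted terms of \<open>D4\<close>.\<close>

lemma D4_theta_quotient:
  assumes q: "norm q < 1" "q \<noteq> 0" and nz: "x \<noteq> 0" "u \<noteq> 0" "w \<noteq> 0"
    and gen: "\<And>k. u \<noteq> q powi k" "\<And>k. w \<noteq> (q ^ 16) powi k" "\<And>k. x * u \<noteq> q powi k"
    and pole: "Theta (- (q ^ 6 * x ^ 4 * w)) (q ^ 4) \<noteq> 0"
  shows "D4 x u w q = w * qpochhammer_inf (q ^ 4) (q ^ 4) ^ 3 / (Theta (x * u) q * Theta w (q ^ 16)) *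
     (theta_numerator q u w 4 x / Theta (- (q ^ 6 * x ^ 4 * w)) (q ^ 4))"
proof -
  have choose2: "choose2 2 = 1" "choose2 3 = 3" "choose2 4 = 6" by (simp_all add: choose2_def)
  have mv: "pole_var q w 4 x = - (q ^ 6 * x ^ 4 * w)"
    by (simp add: pole_var_def choose2)
  have "Theta (x * u) q \<noteq> 0"
    using Theta_eq_0_iff[OF q, of "x * u"] nz gen(3) by simp
  hence "x \<notin> singular_points q u w 4"
    using pole by (simp add: singular_points_def mv)
  from appell_m_multisection[OF q _ nz(2) gen(1) nz(3) _ nz(1) this] gen(2)
  have "appell_m x u q = (\<Sum>r<4. appell_part q w 4 r x)
    + w * qpochhammer_inf (q ^ 4) (q ^ 4) ^ 3 / (Theta (x * u) q * Theta w (q ^ 16)) *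
     (theta_numerator q u w 4 x / Theta (pole_var q w 4 x) (q ^ 4))"
    by simp
  moreover have "(\<Sum>r<4. f r) = f 0 + f 1 + f 2 + f (3 :: nat)" for f :: "nat \<Rightarrow> complex"
    by (simp add: eval_nat_numeral)
  ultimately have "appell_m x u q = appell_part q w 4 0 x + appell_part q w 4 1 x + appell_part q w 4 2 x + appell_part q w 4 3 x
    + w * qpochhammer_inf (q ^ 4) (q ^ 4) ^ 3 / (Theta (x * u) q * Theta w (q ^ 16)) *
     (theta_numerator q u w 4 x / Theta (- (q ^ 6 * x ^ 4 * w)) (q ^ 4))"
    unfolding mv by simp
  moreover have "appell_part q w 4 0 x = appell_m (- (q ^ 6 * x ^ 4)) w (q ^ 16)"
    by (simp add: appell_part_def choose2)
  moreover have "appell_part q w 4 1 x = - (q powi (-1) * x * appell_m (- (q ^ 2 * x ^ 4)) w (q ^ 16))"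
    by (simp add: appell_part_def choose2)
  moreover have "appell_part q w 4 2 x = q powi (-3) * x ^ 2 * appell_m (- (q powi (-2) * x ^ 4)) w (q ^ 16)"
    by (simp add: appell_part_def choose2)
  moreover have "appell_part q w 4 3 x = - (q powi (-6) * x ^ 3 * appell_m (- (q powi (-6) * x ^ 4)) w (q ^ 16))"
    by (simp add: appell_part_def choose2)
  ultimately show ?thesis
    unfolding D4_def by simp
qed

text \<open>Since \<open>u = - z^4\<close> and \<open>w = u^4\<close>, the second theta factors are \<open>\<Theta>(q^(4r);q^16)\<close>, and since
  \<open>pole_var x * u = q^6\<close>, the first ones are \<open>\<Theta>(q^(6+r);q^4)\<close>. The summands with \<open>r = 0\<close> and \<open>r = 2\<close>
  vanish, and the other two have a common factor next to the odd and the even part of \<open>\<Theta>(z^2;q)\<close>.\<close>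

lemma theta_numerator_special:
  assumes q: "norm q < 1" "q \<noteq> 0" and z: "z \<noteq> 0"
    and nz: "Theta (- (q * z ^ 4)) (q ^ 4) \<noteq> 0" "Theta (- (q ^ 3 * z ^ 4)) (q ^ 4) \<noteq> 0"
  shows "theta_numerator q (- (z ^ 4)) (z ^ 16) 4 (- (z powi (-5))) =
    - (Theta q (q ^ 4) * Theta (q ^ 4) (q ^ 16) * Theta (z\<^sup>2) q) /
      (q ^ 3 * z ^ 3 * (Theta (- (q * z ^ 4)) (q ^ 4) * Theta (- (q ^ 3 * z ^ 4)) (q ^ 4)))"
proof -
  define x where "x = - (z powi (-5))"
  have q4: "norm (q ^ 4) < 1" "q ^ 4 \<noteq> 0" and q16: "norm (q ^ 16) < 1" "q ^ 16 \<noteq> 0"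
    using q by (auto intro: norm_power_less_1)
  have choose2: "choose2 2 = 1" "choose2 3 = 3" "choose2 4 = 6" by (simp_all add: choose2_def)
  have zx: "z ^ 5 * x = - 1" using z by (simp add: x_def power_int_minus)
  have xu: "- (x * - (z ^ 4)) = - (1 / z)"
    using z zx by (simp add: field_simps eval_nat_numeral)
  have "(z ^ 5 * x) ^ 4 = 1" unfolding zx by simp
  hence "x ^ 4 * z ^ 16 * z ^ 4 = 1"
    by (simp add: power_mult_distrib mult_ac flip: power_mult power_add)
  hence mu: "pole_var q (z ^ 16) 4 x * - (z ^ 4) = q ^ 6"
    by (simp add: pole_var_def choose2 mult.assoc)
  have T1: "Theta (q ^ 1 * pole_var q (z ^ 16) 4 x * - (z ^ 4)) (q ^ 4) = - Theta q (q ^ 4) / q ^ 3"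
  proof -
    have "Theta (q ^ 4 * q ^ 3) (q ^ 4) = - Theta (q ^ 3) (q ^ 4) / q ^ 3"
      by (rule Theta_shift[OF q4]) (use q in simp)
    also have "Theta (q ^ 3) (q ^ 4) = Theta q (q ^ 4)"
      using Theta_reflect[OF q4(2), of q] q by (simp add: eval_nat_numeral)
    finally show ?thesis unfolding mult.assoc mu by (simp flip: power_add power_Suc)
  qed
  have T2: "Theta (q ^ 2 * pole_var q (z ^ 16) 4 x * - (z ^ 4)) (q ^ 4) = 0"
  proof -
    have "Theta ((q ^ 4) powi 2) (q ^ 4) = 0"
      by (rule iffD2[OF Theta_eq_0_iff[OF q4] exI[of _ 2]]) (use q in simp_all)
    thus ?thesis unfolding mult.assoc mu by (simp flip: power_add power_mult)
  qed
  have T3: "Theta (q ^ 3 * pole_var q (z ^ 16) 4 x * - (z ^ 4)) (q ^ 4) = Theta q (q ^ 4) / q ^ 6"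
  proof -
    have "Theta (q ^ 4 * q ^ 5) (q ^ 4) = - Theta (q ^ 5) (q ^ 4) / q ^ 5"
      by (rule Theta_shift[OF q4]) (use q in simp)
    also have "Theta (q ^ 4 * q) (q ^ 4) = - Theta q (q ^ 4) / q"
      by (rule Theta_shift[OF q4 q(2)])
    hence "Theta (q ^ 5) (q ^ 4) = - Theta q (q ^ 4) / q"
      by (simp add: eval_nat_numeral mult_ac)
    also have "- (- Theta q (q ^ 4) / q) / q ^ 5 = Theta q (q ^ 4) / q ^ 6"
      by (simp add: eval_nat_numeral)
    finally show ?thesis unfolding mult.assoc mu by (simp flip: power_add)
  qed
  have V0: "Theta (q ^ (4 * 0) * (- (z ^ 4)) ^ 4 / z ^ 16) (q ^ 4\<^sup>2) = 0"
    using z q16 by (simp flip: power_mult)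
  have V1: "Theta (q ^ (4 * 1) * (- (z ^ 4)) ^ 4 / z ^ 16) (q ^ 4\<^sup>2) = Theta (q ^ 4) (q ^ 16)"
    using z by (simp flip: power_mult)
  have V3: "Theta (q ^ (4 * 3) * (- (z ^ 4)) ^ 4 / z ^ 16) (q ^ 4\<^sup>2) = Theta (q ^ 4) (q ^ 16)"
  proof -
    have "q ^ 16 / q ^ 4 = q ^ 12" using q by (simp add: field_simps flip: power_add)
    thus ?thesis
      using z Theta_reflect[OF q16(2), of "q ^ 4"] by (simp flip: power_mult)
  qed
  define a b E F where "a = Theta q (q ^ 4)" and "b = Theta (q ^ 4) (q ^ 16)"
    and "E = Theta (- (q * z ^ 4)) (q ^ 4)" and "F = Theta (- (q ^ 3 * z ^ 4)) (q ^ 4)"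
  have "(\<Sum>r<4. f r) = f 0 + f 1 + f 2 + f (3 :: nat)" for f :: "nat \<Rightarrow> complex"
    by (simp add: eval_nat_numeral)
  hence "theta_numerator q (- (z ^ 4)) (z ^ 16) 4 x =
      q powi choose2 1 * (- (1 / z)) ^ 1 * (- a / q ^ 3) * b / E + q powi choose2 3 * (- (1 / z)) ^ 3 * (a / q ^ 6) * b / F"
    unfolding theta_numerator_def by (simp only: V0 V1 V3 T1 T2 T3 xu a_def b_def E_def F_def) simp
  also have "\<dots> = - (a * b * (E - z\<^sup>2 * F)) / (q ^ 3 * z ^ 3 * (E * F))"
  proof -
    have "E \<noteq> 0" "F \<noteq> 0" using nz by (simp_all add: E_def F_def)
    thus ?thesis
      using q z by (simp add: choose2 divide_simps) (simp add: algebra_simps eval_nat_numeral)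
  qed
  also have "E - z\<^sup>2 * F = Theta (z\<^sup>2) q"
    using Theta_even_odd[OF q, of "z\<^sup>2"] z by (simp add: E_def F_def flip: power_mult)
  finally show ?thesis
    by (simp only: x_def a_def b_def E_def F_def)
qed

theorem theorem4p2:
  fixes q z :: complex
  assumes q: "0 < norm q" "norm q < 1"
    and z: "z \<noteq> 0"
    and defined1: "D4_defined (- (z powi (-5))) z (z ^ 16) q"
    and defined2: "D4_defined (- (z powi (-5))) (- (z ^ 4)) (z ^ 16) q"
    and denominator:
      "qpochhammer_inf (q ^ 8) (q ^ 8) * Theta z q * Theta (- (q * z ^ 4)) (q ^ 2)
         * Theta (- (q ^ 2 * z ^ 4)) (q ^ 4) * Theta (z ^ 16) (q ^ 16) \<noteq> 0"
  shows "D4 (- (z powi (-5))) z (z ^ 16) q = D4 (- (z powi (-5))) (- (z ^ 4)) (z ^ 16) q \<and>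
    D4 (- (z powi (-5))) (- (z ^ 4)) (z ^ 16) q =
      q powi (-1) * z ^ 10 * qpochhammer_inf q q * qpochhammer_inf (q ^ 4) (q ^ 4) ^ 3
        * qpochhammer_inf (q ^ 16) (q ^ 16) * Theta (z ^ 2) q
      / (qpochhammer_inf (q ^ 8) (q ^ 8) * Theta z q * Theta (- (q * z ^ 4)) (q ^ 2)
         * Theta (- (q ^ 2 * z ^ 4)) (q ^ 4) * Theta (z ^ 16) (q ^ 16))"
proof
  define x where "x = - (z powi (-5))"
  have q0: "q \<noteq> 0" using q by auto
  have x0: "x \<noteq> 0" using z by (simp add: x_def)
  have xz: "x * z = - (1 / z ^ 4)"
    using z by (simp add: x_def power_int_minus field_simps eval_nat_numeral)
  have gen1: "z \<noteq> q powi k" "x * z \<noteq> q powi k" for k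
    using defined1 by (auto simp: D4_defined_def appell_m_defined_def x_def)
  have gen2: "- (z ^ 4) \<noteq> q powi k" "x * - (z ^ 4) \<noteq> q powi k" "z ^ 16 \<noteq> (q ^ 16) powi k" for k
    using defined2 by (auto simp: D4_defined_def appell_m_defined_def x_def)
  have "1 / (x * z) = - (z ^ 4)"
    using z by (simp add: xz)
  hence "appell_m x z q = appell_m x (- (z ^ 4)) q"
    using appell_m_swap[OF q(2) q0 x0 z gen1] by simp
  thus "D4 (- (z powi (-5))) z (z ^ 16) q = D4 (- (z powi (-5))) (- (z ^ 4)) (z ^ 16) q"
    by (simp add: D4_def x_def)

  define J where "J = (\<lambda>k :: nat. qpochhammer_inf (q ^ k) (q ^ k))"
  define Z G P W S where "Z = Theta z q" and "G = Theta (- (q * z ^ 4)) (q ^ 2)"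
    and "P = Theta (- (q ^ 2 * z ^ 4)) (q ^ 4)" and "W = Theta (z ^ 16) (q ^ 16)"
    and "S = Theta (z ^ 2) q"
  define a b E F where "a = Theta q (q ^ 4)" and "b = Theta (q ^ 4) (q ^ 16)"
    and "E = Theta (- (q * z ^ 4)) (q ^ 4)" and "F = Theta (- (q ^ 3 * z ^ 4)) (q ^ 4)"
  have J0: "J k \<noteq> 0" if "k > 0" for k
    unfolding J_def by (intro qpochhammer_inf_self_nonzero norm_power_less_1 q that)
  have nz: "Z \<noteq> 0" "G \<noteq> 0" "P \<noteq> 0" "W \<noteq> 0"
    using denominator by (auto simp: Z_def G_def P_def W_def)
  \<comment> \<open>These identities express all remaining theta constants and \<open>E * F\<close> by \<open>G\<close> and the products \<open>J k\<close>.\<close>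
  have EF: "E * F * J 2 = G * J 4 ^ 2"
  proof -
    have "q\<^sup>2 * (q * z ^ 4) = q ^ 3 * z ^ 4" "(q\<^sup>2)\<^sup>2 = q ^ 4"
      by (simp_all add: eval_nat_numeral)
    note eqs = this
    show ?thesis
      using Theta_base_split[of "q\<^sup>2" "- (q * z ^ 4)"] norm_power_less_1[OF q(2), of 2] q0 z
      by (simp add: E_def F_def G_def J_def eqs)
  qed
  have a: "a * J 2 = J 1 * J 4"
    using Theta_self_base_4[OF q(2) q0] by (simp add: a_def J_def)
  have b: "b * J 8 = J 4 * J 16"
    using Theta_self_base_4[of "q ^ 4"] norm_power_less_1[OF q(2), of 4] q0
    by (simp add: b_def J_def flip: power_mult)
  have EF0: "E \<noteq> 0" "F \<noteq> 0"
    using EF nz J0[of 4] by auto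
  have sum: "theta_numerator q (- (z ^ 4)) (z ^ 16) 4 x = - (a * b * S) / (q ^ 3 * z ^ 3 * (E * F))"
    unfolding x_def a_def b_def S_def E_def F_def
    by (rule theta_numerator_special[OF q(2) q0 z EF0[unfolded E_def F_def]])
  have xu: "Theta (x * - (z ^ 4)) q = - Z / z"
  proof -
    have "x * - (z ^ 4) = 1 / z"
      using z by (simp add: x_def power_int_minus field_simps eval_nat_numeral)
    thus ?thesis
      using Theta_inverse[OF q(2) q0 z] by (simp add: Z_def)
  qed
  \<comment> \<open>Reflection and one shift turn the denominator of the multisection formula into the given one.\<close>
  have pole: "Theta (- (q ^ 6 * x ^ 4 * z ^ 16)) (q ^ 4) = P * z ^ 4 / q ^ 2"
  proof -
    have "- (q ^ 6 * x ^ 4 * z ^ 16) = q ^ 4 * - (q ^ 2 / z ^ 4)"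
      using z by (simp add: x_def power_int_minus field_simps flip: power_mult power_add)
    hence "Theta (- (q ^ 6 * x ^ 4 * z ^ 16)) (q ^ 4) = - Theta (- (q ^ 2 / z ^ 4)) (q ^ 4) / - (q ^ 2 / z ^ 4)"
      using Theta_shift[of "q ^ 4" "- (q ^ 2 / z ^ 4)"] norm_power_less_1[OF q(2), of 4] q0 z by simp
    also have "Theta (- (q ^ 2 / z ^ 4)) (q ^ 4) = P"
    proof -
      have "- (y / c) = y * y / - (y * c)" if "y \<noteq> 0" for y c :: complex
        using that by simp
      from this[of "q ^ 2" "z ^ 4"] have "- (q ^ 2 / z ^ 4) = q ^ 4 / - (q ^ 2 * z ^ 4)"
        unfolding power_add[symmetric] using q0 by simp
      thus ?thesis
        using Theta_reflect[of "q ^ 4" "- (q ^ 2 * z ^ 4)"] q0 by (simp add: P_def)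
    qed
    finally show ?thesis by simp
  qed
  have "D4 x (- (z ^ 4)) (z ^ 16) q = z ^ 16 * J 4 ^ 3 / (- Z / z * W) * (- (a * b * S) / (q ^ 3 * z ^ 3 * (E * F)) / (P * z ^ 4 / q ^ 2))"
    unfolding sum[symmetric] pole[symmetric] xu[symmetric] J_def W_def
    using nz z q0 by (intro D4_theta_quotient q(2) q0 x0 gen2) (simp_all add: pole)
  also have "\<dots> = z ^ 10 * J 4 ^ 3 * S * (a * b) / (q * Z * W * P * (E * F))"
    using nz z q0 EF0 by (simp add: divide_simps) (simp add: eval_nat_numeral)
  also have "a = J 1 * J 4 / J 2"
    using a J0[of 2] by (simp add: field_simps)
  also have "b = J 4 * J 16 / J 8"
    using b J0[of 8] by (simp add: field_simps)
  also have "E * F = G * J 4 ^ 2 / J 2"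
    using EF J0[of 2] by (simp add: field_simps)
  also have "z ^ 10 * J 4 ^ 3 * S * (J 1 * J 4 / J 2 * (J 4 * J 16 / J 8)) / (q * Z * W * P * (G * J 4 ^ 2 / J 2))
      = q powi (-1) * z ^ 10 * J 1 * J 4 ^ 3 * J 16 * S / (J 8 * Z * G * P * W)"
    using nz q0 J0[of 2] J0[of 4] J0[of 8]
    by (simp add: power_int_minus divide_simps) (simp add: power2_eq_square)
  finally show "D4 (- (z powi (-5))) (- (z ^ 4)) (z ^ 16) q =
      q powi (-1) * z ^ 10 * qpochhammer_inf q q * qpochhammer_inf (q ^ 4) (q ^ 4) ^ 3
        * qpochhammer_inf (q ^ 16) (q ^ 16) * Theta (z ^ 2) q
      / (qpochhammer_inf (q ^ 8) (q ^ 8) * Theta z q * Theta (- (q * z ^ 4)) (q ^ 2)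
         * Theta (- (q ^ 2 * z ^ 4)) (q ^ 4) * Theta (z ^ 16) (q ^ 16))"
    by (simp only: J_def Z_def G_def P_def W_def S_def x_def power_one_right)
qed

end
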